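(* Let $\{\mathcal{T}(t)\}_{t\ge 0}$ be the symmetric telegraph process with speed $c>0$ and rate $\lambda>0$, and let $t>0$. For every integer $k\ge 0$, $$P\Bigl\{ \max_{0\le s\le t} \mathcal{T}(s) = 0 \,\Big|\, V(0) = -c,\ N(t) = 2k+1\Bigr\} = P\Bigl\{ \max_{0\le s\le t} \mathcal{T}(s) = 0 \,\Big|\, V(0) = -c,\ N(t) = 2k+2\Bigr\}$$ and $$P\Bigl\{ \max_{0\le s\le t} \mathcal{T}(s) = 0 \,\Big|\, V(0) = -c,\ N(t) = 2k+1\Bigr\} = \frac{2k+1}{2k+2}\, P\Bigl\{ \max_{0\le s\le t} \mathcal{T}(s) = 0 \,\Big|\, V(0) = -c,\ N(t) = 2k\Bigr\},$$ so that $$P\Bigl\{ \max_{0\le s\le t} \mathcal{T}(s) = 0 \,\Big|\, V(0) = -c,\ N(t) = 2k\Bigr\} > P\Bigl\{ \max_{0\le s\le t} \mathcal{T}(s) = 0 \,\Big|\, V(0) = -c,\ N(t) = 2k+1\Bigr\}.$$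
   Context: Let $c>0$, $\lambda>0$. Let $V(0)$ be a random variable with $P\{V(0)=c\}=P\{V(0)=-c\}=\tfrac12$ and let $\{N(t)\}_{t\ge0}$ be a homogeneous Poisson process with rate $\lambda$, independent of $V(0)$. The symmetric telegraph process is $\mathcal{T}(t)=\int_0^t V(0)(-1)^{N(s)}\,ds$, $t\ge 0$ (so $\mathcal{T}(0)=0$). *)

theory Defs
  imports "HOL-Probability.Probability"
begin

text \<open>
  Path regularity is required for every outcome rather than almost surely, so that path functionals
  such as a running maximum are measurable without assuming the space complete.
  The path values and increments are natural numbers; by monotonicity of the paths the truncated
  subtraction below is the true one. The values \<^term>\<open>N t\<close> for negative \<^term>\<open>t\<close> are irrelevant.
\<close>

definition (in prob_space) homogeneous_poisson_process ::
    "real \<Rightarrow> (real \<Rightarrow> 'a \<Rightarrow> nat) \<Rightarrow> bool" where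
  "homogeneous_poisson_process rate N \<longleftrightarrow>
     (\<forall>t\<ge>0. random_variable (count_space UNIV) (N t)) \<and>
     (\<forall>\<omega>\<in>space M. N 0 \<omega> = 0) \<and>
     (\<forall>\<omega>\<in>space M. mono_on {0..} (\<lambda>t. N t \<omega>)) \<and>
     (\<forall>\<omega>\<in>space M. \<forall>t\<ge>0. ((\<lambda>s. N s \<omega>) \<longlongrightarrow> N t \<omega>) (at_right t)) \<and>
     (\<forall>n. \<forall>\<tau>::nat \<Rightarrow> real. 0 \<le> \<tau> 0 \<longrightarrow> (\<forall>i<n. \<tau> i < \<tau> (Suc i)) \<longrightarrow>
        indep_vars (\<lambda>_. count_space UNIV) (\<lambda>i \<omega>. N (\<tau> (Suc i)) \<omega> - N (\<tau> i) \<omega>) {..<n}) \<and>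
     (\<forall>s t. 0 \<le> s \<longrightarrow> s < t \<longrightarrow>
        distr M (count_space UNIV) (\<lambda>\<omega>. N t \<omega> - N s \<omega>) =
        measure_pmf (poisson_pmf (rate * (t - s))))"

definition telegraph :: "('a \<Rightarrow> real) \<Rightarrow> (real \<Rightarrow> 'a \<Rightarrow> nat) \<Rightarrow> real \<Rightarrow> 'a \<Rightarrow> real" where
  "telegraph V N t \<omega> = integral {0..t} (\<lambda>s. V \<omega> * (- 1) ^ N s \<omega>)"

text \<open>For continuous paths, in particular those of \<^const>\<open>telegraph\<close>, the supremum is attained
  and so is the maximum; see \<open>running_max_telegraph_attained\<close> below.\<close>

definition running_max :: "(real \<Rightarrow> 'a \<Rightarrow> real) \<Rightarrow> real \<Rightarrow> 'a \<Rightarrow> real" where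
  "running_max X t \<omega> = (SUP s\<in>{0..t}. X s \<omega>)"

lemma telegraph_integrable:
  fixes N :: "real \<Rightarrow> 'a \<Rightarrow> nat"
  assumes "mono_on {0..} (\<lambda>t. N t \<omega>)"
  shows "(\<lambda>s. V \<omega> * (- 1) ^ N s \<omega> :: real) integrable_on {0..t}"
proof -
  define g where "g = (\<lambda>s. N (max 0 s) \<omega>)"
  have "mono (\<lambda>s. real (g s))"
    using assms by (auto simp: g_def mono_on_def intro!: monoI)
  then have "(\<lambda>s. real (g s)) \<in> borel_measurable borel"
    by (rule borel_measurable_mono)
  then have "(\<lambda>s. nat \<lfloor>real (g s)\<rfloor>) \<in> measurable borel (count_space UNIV)"
    by measurable
  then have g: "g \<in> measurable borel (count_space UNIV)"
    by simp
  have m: "(\<lambda>s. V \<omega> * (- 1) ^ g s) \<in> borel_measurable lborel"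
    using measurable_compose[OF g, of "\<lambda>n. V \<omega> * (- 1) ^ n" borel] by simp
  have "set_integrable lborel {0..t} (\<lambda>s. V \<omega> * (- 1) ^ g s)"
    unfolding set_integrable_def
    by (rule integrableI_bounded_set_indicator[where B = "\<bar>V \<omega>\<bar>"])
      (use m in \<open>auto simp: abs_mult power_abs emeasure_lborel_Icc_eq\<close>)
  then have "(\<lambda>s. V \<omega> * (- 1) ^ g s) integrable_on {0..t}"
    by (rule set_borel_integral_eq_integral(1))
  then show ?thesis
    by (rule integrable_eq) (auto simp: g_def)
qed

lemma running_max_telegraph_attained:
  fixes N :: "real \<Rightarrow> 'a \<Rightarrow> nat"
  assumes "mono_on {0..} (\<lambda>t. N t \<omega>)" and "0 \<le> t"
  shows "\<exists>s\<in>{0..t}. telegraph V N s \<omega> = running_max (telegraph V N) t \<omega> \<and>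
    (\<forall>u\<in>{0..t}. telegraph V N u \<omega> \<le> telegraph V N s \<omega>)"
proof -
  have "continuous_on {0..t} (\<lambda>s. telegraph V N s \<omega>)"
    unfolding telegraph_def
    by (rule indefinite_integral_continuous_1[OF telegraph_integrable[of N \<omega>, OF assms(1)]])
  then obtain s where s: "s \<in> {0..t}" "\<forall>u\<in>{0..t}. telegraph V N u \<omega> \<le> telegraph V N s \<omega>"
    using continuous_attains_sup[of "{0..t}" "\<lambda>s. telegraph V N s \<omega>"] assms(2) by auto
  then have "running_max (telegraph V N) t \<omega> = telegraph V N s \<omega>"
    unfolding running_max_def by (intro cSup_eq_maximum) auto
  with s show ?thesis by auto
qed

end

theory Submission
  imports Defs
begin

text \<open>
  Given \<open>N t = n\<close>, the gaps before the \<open>n\<close> jumps are uniformly distributed on the simplex of positive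
  vectors with sum at most \<open>t\<close>. By independence of increments this holds for all cylinder events, hence
  for the law of the whole path. The volume of the gap vectors for which a particle at depth
  \<open>x\<close> stays below \<open>0\<close> satisfies a recursion in the first gap, which in the coordinates
  \<open>(t + x) / 2\<close> and \<open>(t - x) / 2\<close> is solved by binomial sums with reflected signs. At \<open>x = 0\<close> they
  collapse to a single term, and the conditional probability is \<open>(n choose (n div 2)) / 2 ^ n\<close>.
\<close>

subsection \<open>Paths with given gaps between jumps\<close>

text \<open>Independence of increments controls finitely many times, whereas the maximum depends on
  a continuum of them. The event is therefore rewritten as membership of the restricted path in a
  measurable set of the product space, where two measures are compared: the Poisson path law on
  \<open>N t = n\<close>, and the image of Lebesgue measure on gap vectors under
  \<open>jump_path\<close>. They agree on grids up to the factor
  \<open>exp (- r * t) * r ^ n\<close>, so neither exponential waiting times nor conditional laws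
  have to be constructed. In the quotient this factor and the probability of \<open>V = - c\<close>
  cancel, so the result depends on none of \<open>c\<close>, \<open>rate\<close> and
  \<open>t\<close>. The volume is needed for every depth \<open>x\<close> and both directions, since
  the first turn already leaves the case \<open>x = 0\<close>.\<close>

text \<open>The gaps between jumps are listed backwards: the first of \<open>n\<close> gaps is \<open>g (n - 1)\<close>, so that
  prepending a gap to \<open>g\<close> is the update of \<open>g\<close> at \<open>n\<close> and needs no shift of indices.\<close>

primrec jump_path :: "nat \<Rightarrow> (nat \<Rightarrow> real) \<Rightarrow> real \<Rightarrow> nat" where
  "jump_path 0 g s = 0"
| "jump_path (Suc n) g s = (if s < g n then 0 else Suc (jump_path n g (s - g n)))"

text \<open>A particle moving with unit speed starts at distance \<open>x\<close> below the barrier; \<open>down\<close> is its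
  initial direction. It must make all its \<open>n\<close> turns before time \<open>t\<close> without passing the barrier.\<close>

primrec stays :: "nat \<Rightarrow> bool \<Rightarrow> real \<Rightarrow> real \<Rightarrow> (nat \<Rightarrow> real) \<Rightarrow> bool" where
  "stays 0 down x t g \<longleftrightarrow> 0 \<le> t \<and> (down \<or> t \<le> x)"
| "stays (Suc n) down x t g \<longleftrightarrow>
    (if down then stays n False (x + g n) (t - g n) g
     else g n \<le> x \<and> stays n True (x - g n) (t - g n) g)"

lemma jump_path_upd: "m \<le> n \<Longrightarrow> jump_path m (g(n := u)) s = jump_path m g s"
  by (induction m arbitrary: s) auto

lemma stays_upd: "m \<le> n \<Longrightarrow> stays m down x t (g(n := u)) = stays m down x t g"
  by (induction m arbitrary: down x t) auto

lemma jump_path_nonpos: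
  assumes "\<forall>i<n. 0 < g i" "s \<le> 0"
  shows "jump_path n g s = 0"
  using assms by (cases n) (auto simp: not_less)

lemma mono_jump_path: "mono (jump_path n g)"
proof (induction n)
  case (Suc n)
  then show ?case by (auto simp: mono_def)
qed (auto simp: mono_def)

lemma jump_path_right_const: "eventually (\<lambda>r. jump_path n g r = jump_path n g s) (at_right s)"
proof (induction n arbitrary: s)
  case (Suc n)
  show ?case
  proof (cases "s < g n")
    case True
    then show ?thesis
      unfolding eventually_at_right[OF True] by (intro exI[of _ "g n"]) simp
  next
    case False
    have "eventually (\<lambda>r. jump_path n g (r - g n) = jump_path n g (s - g n)) (at_right s)"
      using Suc.IH[of "s - g n"] unfolding eventually_at_right_to_0[of _ s]
        eventually_at_right_to_0[of _ "s - g n"] by (simp add: algebra_simps)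
    with eventually_at_right_less[of s] show ?thesis
      by eventually_elim (use False in simp)
  qed
qed simp

lemma signed_path_integrable:
  fixes f :: "real \<Rightarrow> nat"
  assumes "mono_on {0..} f"
  shows "(\<lambda>r. (- 1) ^ f r :: real) integrable_on {0..t}"
  using telegraph_integrable[of "\<lambda>s _. f s" "()" "\<lambda>_. 1" t, OF assms] unfolding mult_1 .

text \<open>For \<open>V = - c\<close> the telegraph process is \<open>- c\<close> times this
  unit-speed displacement, so positive values measure depth below the barrier.\<close>

abbreviation disp :: "nat \<Rightarrow> (nat \<Rightarrow> real) \<Rightarrow> real \<Rightarrow> real" where
  "disp n g s \<equiv> integral {0..s} (\<lambda>r. (- 1) ^ jump_path n g r)"

lemma disp_integrable: "(\<lambda>r. (- 1) ^ jump_path n g r :: real) integrable_on {0..t}"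
  by (rule signed_path_integrable[OF mono_on_subset[OF mono_jump_path subset_UNIV]])

lemma disp_before_jump:
  assumes "0 \<le> s" "s \<le> g n"
  shows "disp (Suc n) g s = s"
proof -
  have "disp (Suc n) g s = integral {0..s} (\<lambda>_. 1)"
    \<comment> \<open>If \<open>s = g n\<close>, the path has already jumped at the right endpoint;
      this is a null set.\<close>
    by (rule integral_spike[of "{g n}"]) (use assms in auto)
  then show ?thesis using assms by simp
qed

text \<open>After the first jump the path restarts with all counts raised by one, which reverses
  every sign.\<close>

lemma disp_after_jump:
  assumes "0 \<le> g n" "g n \<le> s"
  shows "disp (Suc n) g s = g n - disp n g (s - g n)"
proof -
  have "disp (Suc n) g s = disp (Suc n) g (g n)
      + integral {g n..s} (\<lambda>r. (- 1) ^ jump_path (Suc n) g r)"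
    using assms by (intro Henstock_Kurzweil_Integration.integral_combine[symmetric] disp_integrable)
  also have "integral {g n..s} (\<lambda>r. (- 1) ^ jump_path (Suc n) g r :: real) =
      integral {0..s - g n} (\<lambda>r. (- 1) ^ jump_path (Suc n) g (r + g n))"
    using integral_shift_real_ivl[of "g n" "g n" s "\<lambda>r. (- 1) ^ jump_path (Suc n) g r :: real"]
    unfolding diff_self by (rule sym)
  also have "\<dots> = integral {0..s - g n} (\<lambda>r. - ((- 1) ^ jump_path n g r))"
    by (intro Henstock_Kurzweil_Integration.integral_cong) auto
  also have "\<dots> = - disp n g (s - g n)" by simp
  finally show ?thesis using assms by (simp only: disp_before_jump)
qed

text \<open>Only the base case of \<open>stays\<close> tests the remaining time; positive gaps carry
  the bound back to the start.\<close>

lemma stays_imp_nonneg: "\<forall>i<n. 0 < g i \<Longrightarrow> stays n down x t g \<Longrightarrow> 0 \<le> t"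
proof (induction n arbitrary: down x t)
  case (Suc n)
  have "0 < g n" using Suc.prems by simp
  moreover have "0 \<le> t - g n"
    using Suc.IH[of _ _ "t - g n"] Suc.prems by (auto split: if_splits)
  ultimately show ?case by simp
qed auto

text \<open>The time interval is split at the first turn. A downward stretch never violates the
  barrier, and an upward one is worst at its end, so the single test \<open>g n \<le> x\<close>
  replaces a condition at every time.\<close>

lemma stays_iff:
  assumes "\<forall>i<n. 0 < g i" "0 \<le> x" "0 \<le> t"
  shows "stays n down x t g \<longleftrightarrow> jump_path n g t = n \<and>
    (\<forall>s\<in>{0..t}. 0 \<le> x + (if down then 1 else - 1) * disp n g s)"
  using assms
proof (induction n arbitrary: down x t)
  case 0
  then show ?case by auto
next
  case (Suc n)
  let ?u = "g n"
  have u: "0 < ?u" and g: "\<forall>i<n. 0 < g i" using Suc.prems by auto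
  show ?case
  proof (cases "?u \<le> t")
    case False
    then have "\<not> stays (Suc n) down x t g"
      using stays_imp_nonneg[OF g, of _ _ "t - ?u"] by auto
    then show ?thesis using False by auto
  next
    case True
    have split: "(\<forall>s\<in>{0..t}. P s (disp (Suc n) g s)) \<longleftrightarrow>
        (\<forall>s\<in>{0..?u}. P s s) \<and> (\<forall>s\<in>{0..t - ?u}. P (s + ?u) (?u - disp n g s))" for P :: "real \<Rightarrow> real \<Rightarrow> bool"
    proof safe
      fix s assume "\<forall>s\<in>{0..t}. P s (disp (Suc n) g s)" "s \<in> {0..?u}"
      then show "P s s" using True disp_before_jump[of s g n] by (auto dest: bspec[of _ _ s])
    next
      fix s assume "\<forall>s\<in>{0..t}. P s (disp (Suc n) g s)" "s \<in> {0..t - ?u}"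
      then show "P (s + ?u) (?u - disp n g s)"
        using u disp_after_jump[of g n "s + ?u"] by (auto dest: bspec[of _ _ "s + ?u"])
    next
      fix s assume a: "\<forall>s\<in>{0..?u}. P s s" "\<forall>s\<in>{0..t - ?u}. P (s + ?u) (?u - disp n g s)" "s \<in> {0..t}"
      show "P s (disp (Suc n) g s)"
      proof (cases "s \<le> ?u")
        case True
        then show ?thesis using a disp_before_jump[of s g n] by auto
      next
        case False
        then show ?thesis using a u disp_after_jump[of g n s] by (auto dest: bspec[of _ _ "s - ?u"])
      qed
    qed
    have jp: "jump_path (Suc n) g t = Suc n \<longleftrightarrow> jump_path n g (t - ?u) = n"
      using True by auto
    show ?thesis
    proof (cases down)
      case down: True
      have "\<forall>s\<in>{0..?u}. 0 \<le> x + s" using Suc.prems by auto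
      then show ?thesis
        using Suc.IH[of "x + ?u" "t - ?u" False] g u True Suc.prems
        unfolding jp split[of "\<lambda>_ d. 0 \<le> x + (if down then 1 else - 1) * d"] using down
        by (simp add: algebra_simps)
    next
      case up: False
      have 1: "(\<forall>s\<in>{0..?u}. 0 \<le> x - s) \<longleftrightarrow> ?u \<le> x" using u by (auto dest: bspec[of _ _ ?u])
      have IH: "?u \<le> x \<Longrightarrow> stays n True (x - ?u) (t - ?u) g \<longleftrightarrow> jump_path n g (t - ?u) = n \<and>
         (\<forall>s\<in>{0..t - ?u}. 0 \<le> x - ?u + disp n g s)"
        using Suc.IH[of "x - ?u" "t - ?u" True] g True by simp
      show ?thesis
        unfolding jp split[of "\<lambda>_ d. 0 \<le> x + (if down then 1 else - 1) * d"] using up IH 1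
        by (auto simp: algebra_simps)
    qed
  qed
qed

subsection \<open>Volumes of the sets of admissible gaps\<close>

text \<open>Differentiation in \<open>a\<close> or \<open>b\<close> only shifts \<open>\<sigma>\<close>, so these polynomials solve the backward
  equations of the particle. The choice \<open>\<sigma> = sgn\<close> is antisymmetric in \<open>a\<close> and \<open>b\<close> and therefore
  vanishes at the barrier \<open>a = b\<close>, as in the reflection principle.\<close>

definition signed_binomial :: "(int \<Rightarrow> real) \<Rightarrow> nat \<Rightarrow> real \<Rightarrow> real \<Rightarrow> real" where
  "signed_binomial \<sigma> n a b =
    (\<Sum>j\<le>n. \<sigma> (2 * int j - int n) * (a ^ j / fact j) * (b ^ (n - j) / fact (n - j)))"

lemma power_fact_deriv:
  "((\<lambda>x::real. x ^ Suc j / fact (Suc j)) has_real_derivative x ^ j / fact j) (at x within S)"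
proof -
  have "((\<lambda>x::real. x ^ Suc j / fact (Suc j)) has_real_derivative
      (real (Suc j) * x ^ j) / fact (Suc j)) (at x within S)"
    by (rule derivative_eq_intros refl | simp)+
  then show ?thesis by (simp add: fact_Suc field_simps del: of_nat_Suc)
qed

lemma signed_binomial_commute:
  "signed_binomial \<sigma> n a b = signed_binomial (\<lambda>d. \<sigma> (- d)) n b a"
  unfolding signed_binomial_def
  by (rule sum.reindex_bij_witness[of _ "\<lambda>j. n - j" "\<lambda>j. n - j"])
     (auto simp: of_nat_diff algebra_simps)

lemma signed_binomial_deriv_left:
  "((\<lambda>a. signed_binomial \<sigma> (Suc n) a b) has_real_derivative
     signed_binomial (\<lambda>d. \<sigma> (d + 1)) n a b) (at a within S)"
proof -
  let ?c = "\<lambda>j. \<sigma> (2 * int j - int n + 1)" and ?r = "\<lambda>j. b ^ (n - j) / fact (n - j)"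
  \<comment> \<open>The term with index 0 is constant in \<open>a\<close>. For the others, 2 (j + 1)
    - (n + 1) = (2 j - n) + 1 is the origin of the shift in \<open>\<sigma>\<close>.\<close>
  have "(\<lambda>a. signed_binomial \<sigma> (Suc n) a b) = (\<lambda>a. \<sigma> (- int (Suc n)) * (b ^ Suc n / fact (Suc n)) +
     (\<Sum>j\<le>n. ?c j * (a ^ Suc j / fact (Suc j)) * ?r j))"
    unfolding signed_binomial_def sum.atMost_Suc_shift by (simp add: algebra_simps del: fact_Suc power_Suc)
  moreover have "(\<dots> has_real_derivative 0 + (\<Sum>j\<le>n. ?c j * (a ^ j / fact j) * ?r j)) (at a within S)"
    by (intro DERIV_add DERIV_const DERIV_sum DERIV_cmult DERIV_cmult_right power_fact_deriv)
  ultimately show ?thesis by (simp add: signed_binomial_def)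
qed

lemma signed_binomial_deriv_right:
  "((\<lambda>b. signed_binomial \<sigma> (Suc n) a b) has_real_derivative
     signed_binomial (\<lambda>d. \<sigma> (d - 1)) n a b) (at b within S)"
  using signed_binomial_deriv_left[of "\<lambda>d. \<sigma> (- d)" n a b S]
  unfolding signed_binomial_commute[of _ _ a] by simp

lemma signed_binomial_zero_right: "signed_binomial \<sigma> n a 0 = \<sigma> (int n) * a ^ n / fact n"
proof -
  have "signed_binomial \<sigma> n a 0 = (\<Sum>j\<in>{n}. \<sigma> (2 * int j - int n) * (a ^ j / fact j) * (0 ^ (n - j) / fact (n - j)))"
    unfolding signed_binomial_def by (rule sum.mono_neutral_right) auto
  then show ?thesis by simp
qed

lemma signed_binomial_sgn_diag: "signed_binomial (\<lambda>d. of_int (sgn d)) n b b = 0"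
proof -
  have "signed_binomial (\<lambda>d. of_int (sgn d)) n b b = signed_binomial (\<lambda>d. of_int (sgn (- d))) n b b"
    by (rule signed_binomial_commute)
  also have "\<dots> = - signed_binomial (\<lambda>d. of_int (sgn d)) n b b"
    by (simp add: signed_binomial_def sum_negf sgn_minus)
  finally show ?thesis by simp
qed

text \<open>On the diagonal, \<open>\<sigma>\<close> may be averaged with its mirror image. Since
  sgn (d + 1) + sgn (1 - d) vanishes for |d| > 1, only the middle survives: one term of weight 1 for
  even \<open>n\<close>, two equal terms of weight 1/2 for odd \<open>n\<close>.\<close>

lemma signed_binomial_sgn_Suc_diag:
  "signed_binomial (\<lambda>d. of_int (sgn (d + 1))) n b b =
     b ^ n * real (n choose (n div 2)) / fact n"
proof -
  let ?S = "\<lambda>\<sigma>. signed_binomial \<sigma> n b b" and ?n = "int n"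
  let ?w = "\<lambda>d::int. if d = 0 then 1 else if \<bar>d\<bar> = 1 then 1 / 2 else (0::real)"
  have "2 * ?S (\<lambda>d. of_int (sgn (d + 1))) =
     ?S (\<lambda>d. of_int (sgn (d + 1))) + ?S (\<lambda>d. of_int (sgn (- d + 1)))"
    using signed_binomial_commute[of "\<lambda>d. of_int (sgn (d + 1))" n b b] by simp
  also have "\<dots> = 2 * ?S ?w"
    unfolding signed_binomial_def sum.distrib[symmetric] sum_distrib_left
    by (intro sum.cong refl) (auto simp: sgn_if)
  also have "?S ?w = (\<Sum>j\<le>n. ?w (2 * int j - ?n) * (b ^ n * real (n choose j) / fact n))"
    unfolding signed_binomial_def
    by (intro sum.cong refl) (auto simp: binomial_fact power_add[symmetric])
  also have "\<dots> = b ^ n * real (n choose (n div 2)) / fact n"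
  proof (cases "even n")
    case True
    then obtain m where m: "n = 2 * m" by (rule evenE)
    have "(\<Sum>j\<le>n. ?w (2 * int j - ?n) * (b ^ n * real (n choose j) / fact n)) =
       (\<Sum>j\<in>{m}. ?w (2 * int j - ?n) * (b ^ n * real (n choose j) / fact n))"
    proof (intro sum.mono_neutral_right ballI)
      fix j assume "j \<in> {..n} - {m}"
      then have "j < m \<or> m < j" by auto
      then have "2 * int j - ?n < - 1 \<or> 1 < 2 * int j - ?n" using m by linarith
      then have "2 * int j - ?n \<noteq> 0" "\<bar>2 * int j - ?n\<bar> \<noteq> 1" by linarith+
      then show "?w (2 * int j - ?n) * (b ^ n * real (n choose j) / fact n) = 0" by simp
    qed (use m in auto)
    then show ?thesis using m by simp
  next
    case False
    then obtain m where m: "n = Suc (2 * m)" by (metis oddE Suc_eq_plus1)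
    have "(\<Sum>j\<le>n. ?w (2 * int j - ?n) * (b ^ n * real (n choose j) / fact n)) =
       (\<Sum>j\<in>{m, Suc m}. ?w (2 * int j - ?n) * (b ^ n * real (n choose j) / fact n))"
    proof (intro sum.mono_neutral_right ballI)
      fix j assume "j \<in> {..n} - {m, Suc m}"
      then have "j < m \<or> Suc m < j" by auto
      then have "2 * int j - ?n < - 1 \<or> 1 < 2 * int j - ?n" using m by linarith
      then have "2 * int j - ?n \<noteq> 0" "\<bar>2 * int j - ?n\<bar> \<noteq> 1" by linarith+
      then show "?w (2 * int j - ?n) * (b ^ n * real (n choose j) / fact n) = 0" by simp
    qed (use m in auto)
    also have "\<dots> = b ^ n * real (n choose m) / fact n"
    proof -
      have "n choose Suc m = n choose m" using binomial_symmetric[of m n] m by simp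
      moreover have "int n = 2 * int m + 1" using m by simp
      ultimately show ?thesis by simp
    qed
    finally show ?thesis using m by simp
  qed
  finally show ?thesis by simp
qed

section \<open>Lebesgue measure on vectors of positive gaps\<close>

abbreviation gapM :: "nat \<Rightarrow> (nat \<Rightarrow> real) measure" where
  "gapM n \<equiv> \<Pi>\<^sub>M i\<in>{..<n}. restrict_space lborel {0<..}"

lemma space_gapM: "space (gapM n) = {..<n} \<rightarrow>\<^sub>E {0<..}"
  by (simp add: space_PiM space_restrict_space)

lemma gapM_component:
  assumes "i < n"
  shows "(\<lambda>g. g i) \<in> borel_measurable (gapM n)"
proof -
  have 1: "(\<lambda>g. g i) \<in> measurable (gapM n) (restrict_space lborel {0<..})"
    using assms by (intro measurable_component_singleton) simp
  have 2: "(\<lambda>x. x) \<in> borel_measurable (restrict_space lborel {(0::real)<..})"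
    by (rule measurable_restrict_space1) simp
  show ?thesis using measurable_compose[OF 1 2] .
qed

text \<open>The time is a function \<open>h\<close> rather than a constant because the recursion
  subtracts a variable gap from it.\<close>

lemma measurable_jump_path:
  assumes "\<And>i. i < n \<Longrightarrow> (\<lambda>x. G x i) \<in> borel_measurable M" "h \<in> borel_measurable M"
  shows "(\<lambda>x. jump_path n (G x) (h x)) \<in> measurable M (count_space UNIV)"
  using assms
proof (induction n arbitrary: h)
  case (Suc n)
  have [measurable]: "(\<lambda>x. G x n) \<in> borel_measurable M" "h \<in> borel_measurable M"
    using Suc.prems by auto
  have "(\<lambda>x. jump_path n (G x) (h x - G x n)) \<in> measurable M (count_space UNIV)"
    by (rule Suc.IH) (use Suc.prems in auto)
  from measurable_compose[OF this measurable_count_space[of Suc]]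
  have [measurable]: "(\<lambda>x. Suc (jump_path n (G x) (h x - G x n))) \<in> measurable M (count_space UNIV)" .
  show ?case by simp
qed simp

lemma measurable_stays:
  assumes "\<And>i. i < n \<Longrightarrow> (\<lambda>x. G x i) \<in> borel_measurable M"
    "X \<in> borel_measurable M" "T \<in> borel_measurable M"
  shows "Measurable.pred M (\<lambda>x. stays n down (X x) (T x) (G x))"
  using assms
proof (induction n arbitrary: down X T)
  case (Suc n)
  have [measurable]: "(\<lambda>x. G x n) \<in> borel_measurable M" "X \<in> borel_measurable M" "T \<in> borel_measurable M"
    using Suc.prems by auto
  have [measurable]: "Measurable.pred M (\<lambda>x. stays n False (X x + G x n) (T x - G x n) (G x))"
    "Measurable.pred M (\<lambda>x. stays n True (X x - G x n) (T x - G x n) (G x))"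
    by (rule Suc.IH; use Suc.prems in auto)+
  show ?case by (cases down) simp_all
qed simp

lemma sigma_finite_restrict_lborel:
  "sigma_finite_measure (restrict_space lborel {(0::real)<..})"
  by (rule sigma_finite_measure_restrict_space) (auto simp: lborel.sigma_finite_measure_axioms)

lemma product_sigma_finite_gapM: "product_sigma_finite (\<lambda>_. restrict_space lborel {(0::real)<..})"
  by (simp add: product_sigma_finite_def sigma_finite_restrict_lborel)

lemma sigma_finite_gapM: "sigma_finite_measure (gapM n)"
  using product_sigma_finite.sigma_finite[OF product_sigma_finite_gapM, of "{..<n}"] by simp

text \<open>Integrates over the first gap last; in the backward numbering it is coordinate
  \<open>n\<close>. The space does not bound the sum of the gaps, so the time constraint has to come
  from \<open>f\<close>.\<close>

lemma gapM_nn_integral_Suc: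
  assumes "f \<in> borel_measurable (gapM (Suc n))"
  shows "(\<integral>\<^sup>+g. f g \<partial>gapM (Suc n)) =
    (\<integral>\<^sup>+u. (\<integral>\<^sup>+g. f (g(n := u)) \<partial>gapM n) * indicator {0<..} u \<partial>lborel)"
proof -
  have "(\<integral>\<^sup>+g. f g \<partial>gapM (Suc n)) =
     (\<integral>\<^sup>+u. (\<integral>\<^sup>+g. f (g(n := u)) \<partial>gapM n) \<partial>restrict_space lborel {0<..})"
    using assms unfolding lessThan_Suc
    by (intro product_sigma_finite.product_nn_integral_insert_rev[OF product_sigma_finite_gapM]) auto
  then show ?thesis by (simp add: nn_integral_restrict_space)
qed

lemma nn_integral_gapM_0: "(\<integral>\<^sup>+g. f g \<partial>gapM 0) = f (\<lambda>_. undefined)"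
  by (simp add: PiM_empty nn_integral_count_space_finite)

text \<open>The second conclusion ensures that \<open>ennreal\<close> does not truncate the
  difference in the first.\<close>

lemma nn_integral_deriv_Icc:
  fixes H h :: "real \<Rightarrow> real"
  assumes "a \<le> b" "h \<in> borel_measurable borel"
    and "\<And>u. a \<le> u \<Longrightarrow> u \<le> b \<Longrightarrow> (H has_real_derivative h u) (at u)"
    and "\<And>u. a \<le> u \<Longrightarrow> u \<le> b \<Longrightarrow> 0 \<le> h u"
  shows "(\<integral>\<^sup>+u. ennreal (h u) * indicator {a..b} u \<partial>lborel) = ennreal (H b - H a)"
    and "H a \<le> H b"
proof -
  show "(\<integral>\<^sup>+u. ennreal (h u) * indicator {a..b} u \<partial>lborel) = ennreal (H b - H a)"
    by (rule nn_integral_FTC_Icc[OF assms(2) assms(3) assms(4) assms(1)]) auto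
  show "H a \<le> H b"
    using assms(3,4) by (intro DERIV_nonneg_imp_nondecreasing[OF assms(1)]) blast
qed

lemma continuous_signed_binomial:
  assumes "continuous_on UNIV f" "continuous_on UNIV g"
  shows "continuous_on UNIV (\<lambda>u::real. signed_binomial \<sigma> n (f u) (g u))"
  unfolding signed_binomial_def by (intro continuous_intros assms) auto

text \<open>In the coordinates \<open>a = (t + x) / 2\<close>, \<open>b = (t - x) / 2\<close> downward motion changes only \<open>b\<close> and
  upward motion changes only \<open>a\<close>. For \<open>t \<le> x\<close> the barrier is out of reach.\<close>

definition stay_vol :: "nat \<Rightarrow> bool \<Rightarrow> real \<Rightarrow> real \<Rightarrow> real" where
  "stay_vol n down x t = (if t \<le> x then t ^ n / fact n
     else signed_binomial (\<lambda>d. of_int (sgn (if down then d + 1 else d))) n ((t + x) / 2) ((t - x) / 2))"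

lemma nn_integral_power_fact:
  fixes b t :: real
  assumes "b \<le> t"
  shows "(\<integral>\<^sup>+u. ennreal ((t - u) ^ n / fact n) * indicator {b..t} u \<partial>lborel) =
    ennreal ((t - b) ^ Suc n / fact (Suc n))"
proof -
  let ?H = "\<lambda>u. - ((t - u) ^ Suc n / fact (Suc n))"
  have "((\<lambda>u. t - u) has_real_derivative - 1) (at u)" for u
    by (auto intro!: derivative_eq_intros)
  from DERIV_minus[OF DERIV_chain'[OF this power_fact_deriv]]
  have H: "(?H has_real_derivative (t - u) ^ n / fact n) (at u)" for u
    by (simp del: power_Suc fact_Suc)
  have "(\<integral>\<^sup>+u. ennreal ((t - u) ^ n / fact n) * indicator {b..t} u \<partial>lborel) = ennreal (?H t - ?H b)"
    by (rule nn_integral_deriv_Icc(1)[OF assms _ H]) auto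
  then show ?thesis by simp
qed

text \<open>Conditioning on the first gap gives an integral of the volume for one gap less, and
  \<open>stay_vol\<close> supplies its antiderivative. Nonnegativity is part of the induction
  because the integrand must be nonnegative to be integrated in \<open>ennreal\<close>.\<close>

lemma stays_volume:
  assumes "0 \<le> x" "0 \<le> t"
  shows "0 \<le> stay_vol n down x t \<and>
    (\<integral>\<^sup>+g. indicator {g. stays n down x t g} g \<partial>gapM n) = ennreal (stay_vol n down x t)"
  using assms
proof (induction n arbitrary: down x t)
  case 0
  then show ?case
    by (auto simp: nn_integral_gapM_0 PiM_empty stay_vol_def signed_binomial_def)
next
  case (Suc n)
  let ?a = "(t + x) / 2" and ?b = "(t - x) / 2"
  \<comment> \<open>The longest admissible first gap: time alone limits a downward stretch, the
    barrier also limits an upward one.\<close>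
  let ?m = "if down then t else min x t"
  define v where "v u = (if down then stay_vol n False (x + u) (t - u) else stay_vol n True (x - u) (t - u))" for u
  have v_nonneg: "0 \<le> v u" if "0 \<le> u" "u \<le> ?m" for u
    using that Suc.IH[of "x + u" "t - u" False] Suc.IH[of "x - u" "t - u" True] Suc.prems
    by (auto simp: v_def split: if_splits)
  have inner: "(\<integral>\<^sup>+g. indicator {g. stays (Suc n) down x t g} (g(n := u)) \<partial>gapM n) =
      ennreal (v u) * indicator {0..?m} u" if u: "0 < u" for u
  proof (cases "u \<le> ?m")
    case True
    have "(\<integral>\<^sup>+g. indicator {g. stays (Suc n) down x t g} (g(n := u)) \<partial>gapM n) =
       (\<integral>\<^sup>+g. indicator {g. stays n (\<not> down) (if down then x + u else x - u) (t - u) g} g \<partial>gapM n)"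
      using True by (intro nn_integral_cong) (auto simp: indicator_def stays_upd split: if_splits)
    also have "\<dots> = ennreal (v u)"
      using True u Suc.IH[of "x + u" "t - u" False] Suc.IH[of "x - u" "t - u" True] Suc.prems
      by (auto simp: v_def split: if_splits)
    finally show ?thesis using True u by simp
  next
    case False
    have "\<not> stays (Suc n) down x t (g(n := u))" if g: "g \<in> space (gapM n)" for g
    proof
      assume st: "stays (Suc n) down x t (g(n := u))"
      have "\<forall>i<n. 0 < g i" using g by (auto simp: space_gapM)
      with st have "u \<le> t" "\<not> down \<longrightarrow> u \<le> x"
        using stays_imp_nonneg[of n g _ _ "t - u"] by (auto simp: stays_upd split: if_splits)
      with False show False by (auto split: if_splits)
    qed
    then have "(\<integral>\<^sup>+g. indicator {g. stays (Suc n) down x t g} (g(n := u)) \<partial>gapM n) = (\<integral>\<^sup>+g. 0 \<partial>gapM n)"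
      by (intro nn_integral_cong) (auto simp: indicator_def)
    then show ?thesis using False by simp
  qed
  have "(\<integral>\<^sup>+g. indicator {g. stays (Suc n) down x t g} g \<partial>gapM (Suc n)) =
     (\<integral>\<^sup>+u. (\<integral>\<^sup>+g. indicator {g. stays (Suc n) down x t g} (g(n := u)) \<partial>gapM n) * indicator {0<..} u \<partial>lborel)"
  proof (rule gapM_nn_integral_Suc)
    have "Measurable.pred (gapM (Suc n)) (\<lambda>g. stays (Suc n) down x t g)"
      by (rule measurable_stays) (auto intro: gapM_component)
    then show "indicator {g. stays (Suc n) down x t g} \<in> borel_measurable (gapM (Suc n))"
      by (simp only: borel_measurable_indicator_iff pred_def Int_def mem_Collect_eq) (simp add: conj_commute)
  qed
  also have "\<dots> = (\<integral>\<^sup>+u. ennreal (v u) * indicator {0..?m} u \<partial>lborel)"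
  proof (intro nn_integral_cong_AE, rule AE_mp[OF AE_lborel_singleton[of 0]], intro AE_I2 impI)
    fix u :: real assume "u \<noteq> 0"
    then show "(\<integral>\<^sup>+g. indicator {g. stays (Suc n) down x t g} (g(n := u)) \<partial>gapM n) * indicator {0<..} u =
      ennreal (v u) * indicator {0..?m} u"
    proof (cases "0 < u")
      case True
      then show ?thesis by (simp only: inner) simp
    next
      case False
      then show ?thesis using \<open>u \<noteq> 0\<close> by simp
    qed
  qed
  finally have vol: "(\<integral>\<^sup>+g. indicator {g. stays (Suc n) down x t g} g \<partial>gapM (Suc n)) =
     (\<integral>\<^sup>+u. ennreal (v u) * indicator {0..?m} u \<partial>lborel)" .
  show ?case
  proof (cases "t \<le> x")
    case True
    then have "(\<integral>\<^sup>+u. ennreal (v u) * indicator {0..?m} u \<partial>lborel) =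
       (\<integral>\<^sup>+u. ennreal ((t - u) ^ n / fact n) * indicator {0..t} u \<partial>lborel)"
      by (intro nn_integral_cong) (auto simp: v_def stay_vol_def indicator_def)
    then show ?thesis using vol nn_integral_power_fact[of 0 t n] Suc.prems True
      by (simp add: stay_vol_def)
  next
    case xt: False
    have a0: "0 \<le> ?a" and b0: "0 < ?b" using xt Suc.prems by auto
    show ?thesis
    proof (cases down)
      case up: False
      \<comment> \<open>Moving up by \<open>u\<close> replaces \<open>?a\<close> by
        \<open>?a - u\<close> and keeps \<open>?b\<close>. At \<open>u = x\<close> the arguments
        coincide, so the antiderivative vanishes there and only its value at 0 remains.\<close>
      let ?H = "\<lambda>u. - signed_binomial (\<lambda>d. of_int (sgn d)) (Suc n) (?a - u) ?b"
      let ?h = "\<lambda>u. signed_binomial (\<lambda>d. of_int (sgn (d + 1))) n (?a - u) ?b"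
      have v: "v u = ?h u" if "0 \<le> u" "u \<le> x" for u
        using that xt up by (simp add: v_def stay_vol_def field_simps)
      have h: "?h \<in> borel_measurable borel"
        by (intro borel_measurable_continuous_onI continuous_signed_binomial continuous_intros)
      have d: "(?H has_real_derivative ?h u) (at u)" for u
        by (rule derivative_eq_intros DERIV_chain'[OF _ signed_binomial_deriv_left] refl | simp)+
      have pos: "0 \<le> ?h u" if "0 \<le> u" "u \<le> x" for u
        using v[OF that] v_nonneg[of u] that up xt by simp
      note FTC = nn_integral_deriv_Icc[of 0 x ?h ?H, OF Suc.prems(1) h d pos]
      have "?a - x = ?b" by (simp add: field_simps)
      then have H: "?H x - ?H 0 = stay_vol (Suc n) down x t" "?H x = 0"
        using xt up by (simp_all add: stay_vol_def signed_binomial_sgn_diag)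
      have "(\<integral>\<^sup>+u. ennreal (v u) * indicator {0..?m} u \<partial>lborel) =
          (\<integral>\<^sup>+u. ennreal (?h u) * indicator {0..x} u \<partial>lborel)"
        using up xt by (intro nn_integral_cong) (auto simp: v indicator_def)
      then show ?thesis using FTC H vol by simp
    next
      case down: True
      \<comment> \<open>Moving down by \<open>u\<close> keeps \<open>?a\<close> and replaces
        \<open>?b\<close> by \<open>?b - u\<close>. From \<open>u = ?b\<close> on the barrier is out
        of reach and the integrand is the simplex volume \<open>?s\<close>. Its integral cancels the
        boundary term of \<open>?H\<close> at \<open>?b\<close>.\<close>
      let ?H = "\<lambda>u. - signed_binomial (\<lambda>d. of_int (sgn (d + 1))) (Suc n) ?a (?b - u)"
      let ?h = "\<lambda>u. signed_binomial (\<lambda>d. of_int (sgn d)) n ?a (?b - u)"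
      let ?s = "\<lambda>u. (t - u) ^ n / fact n"
      have v: "v u = ?h u" if "0 \<le> u" "u < ?b" for u
        using that xt down by (simp add: v_def stay_vol_def field_simps)
      have v': "v u = ?s u" if "?b \<le> u" "u \<le> t" for u
        using that xt down by (simp add: v_def stay_vol_def field_simps)
      have h: "?h \<in> borel_measurable borel"
        by (intro borel_measurable_continuous_onI continuous_signed_binomial continuous_intros)
      have d: "(?H has_real_derivative ?h u) (at u)" for u
        by (rule derivative_eq_intros DERIV_chain'[OF _ signed_binomial_deriv_right] refl | simp)+
      have pos: "0 \<le> ?h u" if "0 \<le> u" "u \<le> ?b" for u
      proof (cases "u = ?b")
        case True
        then have "?b - u = 0" by simp
        then show ?thesis using a0 by (simp add: signed_binomial_zero_right sgn_if)
      next
        case False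
        then show ?thesis using v[of u] v_nonneg[of u] that down xt Suc.prems by simp
      qed
      note FTC = nn_integral_deriv_Icc[of 0 ?b ?h ?H, OF less_imp_le[OF b0] h d pos]
      have S: "(\<integral>\<^sup>+u. ennreal (?s u) * indicator {?b..t} u \<partial>lborel) = ennreal (?a ^ Suc n / fact (Suc n))"
      proof -
        have "t - ?b = ?a" by (simp add: field_simps)
        moreover have "?b \<le> t" using Suc.prems by simp
        ultimately show ?thesis using nn_integral_power_fact[of ?b t n] by (simp only:)
      qed
      have "(\<integral>\<^sup>+u. ennreal (v u) * indicator {0..?m} u \<partial>lborel) =
          (\<integral>\<^sup>+u. ennreal (?h u) * indicator {0..?b} u + ennreal (?s u) * indicator {?b..t} u \<partial>lborel)"
      \<comment> \<open>At \<open>u = ?b\<close> both indicators are 1, so this point is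
        discarded.\<close>
      proof (intro nn_integral_cong_AE, rule AE_mp[OF AE_lborel_singleton[of ?b]], intro AE_I2 impI)
        fix u assume "u \<noteq> ?b"
        moreover have "?b \<le> t" using Suc.prems by simp
        ultimately show "ennreal (v u) * indicator {0..?m} u =
           ennreal (?h u) * indicator {0..?b} u + ennreal (?s u) * indicator {?b..t} u"
          using down v[of u] v'[of u] b0 by (auto simp: indicator_def simp del: times_divide_eq_right)
      qed
      also have "\<dots> = (\<integral>\<^sup>+u. ennreal (?h u) * indicator {0..?b} u \<partial>lborel) +
          (\<integral>\<^sup>+u. ennreal (?s u) * indicator {?b..t} u \<partial>lborel)"
      proof (rule nn_integral_add)
        have [measurable]: "?h \<in> borel_measurable borel" by (rule h)
        show "(\<lambda>u. ennreal (?h u) * indicator {0..?b} u) \<in> borel_measurable lborel" by measurable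
        show "(\<lambda>u. ennreal (?s u) * indicator {?b..t} u) \<in> borel_measurable lborel" by measurable
      qed
      also have "\<dots> = ennreal (?H ?b - ?H 0) + ennreal (?a ^ Suc n / fact (Suc n))"
        by (simp only: FTC(1) S)
      also have "\<dots> = ennreal ((?H ?b - ?H 0) + ?a ^ Suc n / fact (Suc n))"
        using FTC(2) a0 by (intro ennreal_plus[symmetric]) auto
      also have "(?H ?b - ?H 0) + ?a ^ Suc n / fact (Suc n) = stay_vol (Suc n) down x t"
        using xt down by (simp add: stay_vol_def signed_binomial_zero_right)
      finally have 1: "(\<integral>\<^sup>+u. ennreal (v u) * indicator {0..?m} u \<partial>lborel) = ennreal (stay_vol (Suc n) down x t)" .
      have "stay_vol (Suc n) down x t = (?H ?b - ?H 0) + ?a ^ Suc n / fact (Suc n)"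
        using xt down by (simp add: stay_vol_def signed_binomial_zero_right)
      then have "0 \<le> stay_vol (Suc n) down x t" using FTC(2) a0 by simp
      with 1 vol show ?thesis by simp
    qed
  qed
qed

subsection \<open>The law of the path of a Poisson process with a given number of jumps\<close>

text \<open>Each factor is the volume of the ordered jump times falling between two consecutive grid
  times; the product is the volume of gap vectors whose path meets the grid.\<close>

fun cyl_vol :: "real \<Rightarrow> nat \<Rightarrow> (real \<times> nat) list \<Rightarrow> real" where
  "cyl_vol a j [] = 1"
| "cyl_vol a j ((s, v) # l) = (s - a) ^ (v - j) / fact (v - j) * cyl_vol s v l"

text \<open>Times may coincide, since in the induction the first jump, and with it the new starting
  time, may fall on the first grid time.\<close>

abbreviation grid_mono :: "(real \<times> nat) list \<Rightarrow> bool" where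
  "grid_mono \<equiv> sorted_wrt (\<lambda>p q. fst p \<le> fst q \<and> snd p \<le> snd q)"

text \<open>The path is restarted at time \<open>a\<close> with \<open>j\<close> jumps already made,
  so that an induction can advance the starting point.\<close>

definition through :: "real \<Rightarrow> nat \<Rightarrow> (real \<times> nat) list \<Rightarrow> (real \<Rightarrow> nat) \<Rightarrow> bool" where
  "through a j l f \<longleftrightarrow> (\<forall>p\<in>set l. j + f (fst p - a) = snd p)"

lemma cyl_vol_nonneg: "grid_mono ((a, j) # l) \<Longrightarrow> 0 \<le> cyl_vol a j l"
  by (induction a j l rule: cyl_vol.induct) auto

lemma measurable_through:
  assumes "\<And>i. i < n \<Longrightarrow> (\<lambda>x. G x i) \<in> borel_measurable M"
  shows "Measurable.pred M (\<lambda>x. through a j l (jump_path n (G x)))"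
proof -
  have [measurable]: "(\<lambda>x. jump_path n (G x) s) \<in> measurable M (count_space UNIV)" for s
    using assms by (intro measurable_jump_path) auto
  show ?thesis unfolding through_def by (rule pred_intros_finite) simp_all
qed

lemma borel_measurable_indicator_pred:
  "Measurable.pred M P \<Longrightarrow> (\<lambda>x. indicator {y. P y} x :: ennreal) \<in> borel_measurable M"
  using borel_measurable_indicator_iff[of "{y. P y}" M]
  by (simp add: pred_def Int_def conj_commute)

text \<open>\<open>n + length l\<close> drops in both cases: passing a grid time without a jump
  removes that point, and a jump uses up a gap. The condition on the last point says that all
  \<open>n\<close> gaps are used by the end of the grid.\<close>

lemma through_volume:
  assumes "grid_mono ((a, j) # l)" "snd (last ((a, j) # l)) = j + n"
  shows "(\<integral>\<^sup>+g. indicator {g. through a j l (jump_path n g)} g \<partial>gapM n) = ennreal (cyl_vol a j l)"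
  using assms
proof (induction "n + length l" arbitrary: n a j l rule: less_induct)
  case less
  show ?case
  proof (cases l)
    case Nil
    then show ?thesis using less.prems
      by (simp add: through_def nn_integral_gapM_0 PiM_empty)
  next
    case (Cons p l')
    obtain s v where p: "p = (s, v)" by (cases p)
    have l: "l = (s, v) # l'" using Cons p by simp
    have as: "a \<le> s" "j \<le> v" and srt: "grid_mono ((s, v) # l')"
      and lst: "snd (last ((s, v) # l')) = j + n"
      using less.prems by (auto simp: l)
    have ge: "s \<le> fst q" "v \<le> snd q" if "q \<in> set l" for q
      using srt that by (auto simp: l)
    show ?thesis
    \<comment> \<open>Without a jump in \<open>(a, s]\<close> the first gap is translated by \<open>s - a\<close>; otherwise it is integrated out.\<close>
    proof (cases "v = j")
      case True
      have cyl: "cyl_vol a j l = cyl_vol s j l'" using True by (simp add: l)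
      have IH: "(\<integral>\<^sup>+g. indicator {g. through s j l' (jump_path n g)} g \<partial>gapM n) = ennreal (cyl_vol s j l')"
        by (rule less.hyps) (use srt lst True in \<open>auto simp: l\<close>)
      have "(\<integral>\<^sup>+g. indicator {g. through a j l (jump_path n g)} g \<partial>gapM n) =
         (\<integral>\<^sup>+g. indicator {g. through s j l' (jump_path n g)} g \<partial>gapM n)"
      proof (cases n)
        case 0
        then show ?thesis using True by (simp add: through_def l)
      next
        case (Suc m)
        define F where "F u = (\<integral>\<^sup>+g. indicator {g. through a j l (jump_path n g)} (g(m := u)) \<partial>gapM m)
           * indicator {0<..} u" for u
        define G where "G u = (\<integral>\<^sup>+g. indicator {g. through s j l' (jump_path n g)} (g(m := u)) \<partial>gapM m)
           * indicator {0<..} u" for u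
        have F: "F \<in> borel_measurable borel"
        proof -
          have "Measurable.pred (borel \<Otimes>\<^sub>M gapM m) (\<lambda>p. through a j l (jump_path n ((snd p)(m := fst p))))"
          proof (rule measurable_through)
            fix i assume "i < n"
            then show "(\<lambda>p. ((snd p)(m := fst p)) i) \<in> borel_measurable (borel \<Otimes>\<^sub>M gapM m)"
              using measurable_compose[OF measurable_snd gapM_component[of i m], of borel]
              by (cases "i = m") (simp_all add: Suc)
          qed
          from borel_measurable_indicator_pred[OF this]
          have "(\<lambda>(u, g). indicator {g. through a j l (jump_path n g)} (g(m := u)) :: ennreal)
              \<in> borel_measurable (borel \<Otimes>\<^sub>M gapM m)"
            by (simp add: indicator_def case_prod_beta)
          from sigma_finite_measure.borel_measurable_nn_integral[OF sigma_finite_gapM this]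
          show ?thesis unfolding F_def by measurable
        qed
        \<comment> \<open>For \<open>u \<le> 0\<close> both sides vanish: \<open>G\<close> by its
          indicator, and \<open>F\<close> because a first gap of at most \<open>s - a\<close> would
          force a jump by time \<open>s\<close>.\<close>
        have FG: "F ((s - a) + 1 * u) = G u" for u
        proof (cases "0 < u")
          case True
          have "through a j l (jump_path n (g(m := s - a + u))) \<longleftrightarrow>
              through s j l' (jump_path n (g(m := u)))" for g
            using True \<open>v = j\<close> as unfolding through_def l Suc
            by (auto simp: algebra_simps jump_path_upd)
          then show ?thesis using True as by (simp add: F_def G_def indicator_def)
        next
          case False
          have "\<not> through a j l (jump_path n (g(m := s - a + u)))" for g
            using False \<open>v = j\<close> unfolding through_def l Suc by auto
          then show ?thesis using False by (simp add: F_def G_def indicator_def)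
        qed
        have "(\<integral>\<^sup>+g. indicator {g. through a j l (jump_path n g)} g \<partial>gapM n) = (\<integral>\<^sup>+u. F u \<partial>lborel)"
          unfolding F_def Suc
          by (intro gapM_nn_integral_Suc borel_measurable_indicator_pred measurable_through) (auto intro: gapM_component)
        also have "\<dots> = (\<integral>\<^sup>+u. G u \<partial>lborel)"
          using nn_integral_real_affine[OF F, of 1 "s - a"] unfolding FG by simp
        also have "\<dots> = (\<integral>\<^sup>+g. indicator {g. through s j l' (jump_path n g)} g \<partial>gapM n)"
          unfolding G_def Suc
          by (intro gapM_nn_integral_Suc[symmetric] borel_measurable_indicator_pred measurable_through) (auto intro: gapM_component)
        finally show ?thesis .
      qed
      then show ?thesis using IH cyl by simp
    next
      case False
      then have jv: "Suc j \<le> v" using as by simp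
      have "v \<le> snd (last ((s, v) # l'))"
        using ge(2)[of "last ((s, v) # l')"] by (simp only: l last_in_set list.distinct simp_thms)
      then obtain m where m: "n = Suc m" using lst jv by (cases n) auto
      have C: "0 \<le> cyl_vol s v l'" by (rule cyl_vol_nonneg[OF srt])
      obtain d where d: "v - j = Suc d" using jv by (metis Suc_diff_Suc Suc_le_lessD)
      \<comment> \<open>After a first jump at \<open>a + u\<close>, exactly \<open>d\<close> more
        must occur by time \<open>s\<close>; integrating over \<open>u\<close> raises the degree to
        \<open>Suc d\<close>.\<close>
      have inner: "(\<integral>\<^sup>+g. indicator {g. through a j l (jump_path n g)} (g(m := u)) \<partial>gapM m) =
          ennreal (cyl_vol s v l') * (ennreal ((s - a - u) ^ d / fact d) * indicator {0..s - a} u)"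
        if u: "0 < u" for u
      proof (cases "u \<le> s - a")
        case True
        have "through a j l (jump_path n (g(m := u))) \<longleftrightarrow> through (a + u) (Suc j) l (jump_path m g)" for g
        proof -
          have "\<not> fst q - a < u" if "q \<in> set l" for q using ge(1)[OF that] True by simp
          then show ?thesis unfolding through_def m
            by (auto simp: jump_path_upd algebra_simps)
        qed
        then have "(\<integral>\<^sup>+g. indicator {g. through a j l (jump_path n g)} (g(m := u)) \<partial>gapM m) =
            (\<integral>\<^sup>+g. indicator {g. through (a + u) (Suc j) l (jump_path m g)} g \<partial>gapM m)"
          by (intro nn_integral_cong) (simp add: indicator_def)
        also have "\<dots> = ennreal (cyl_vol (a + u) (Suc j) l)"
        proof (rule less.hyps)
          show "m + length l < n + length l" using m by simp
          have "a + u \<le> fst q" "Suc j \<le> snd q" if "q \<in> set l" for q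
            using ge[OF that] True jv by simp_all
          then show "grid_mono ((a + u, Suc j) # l)" using less.prems(1) by simp
          show "snd (last ((a + u, Suc j) # l)) = Suc j + m" using lst m by (simp add: l)
        qed
        also have "\<dots> = ennreal (cyl_vol s v l' * ((s - a - u) ^ d / fact d))"
        proof -
          have "v - Suc j = d" "s - (a + u) = s - a - u" using d by simp_all
          then show ?thesis unfolding l cyl_vol.simps by (simp only: mult.commute)
        qed
        also have "\<dots> = ennreal (cyl_vol s v l') * ennreal ((s - a - u) ^ d / fact d)"
          using C True by (intro ennreal_mult) auto
        finally show ?thesis using True u by simp
      next
        case False
        then have "\<not> through a j l (jump_path n (g(m := u)))" for g
          using jv by (auto simp: through_def l m)
        then show ?thesis using False by simp
      qed
      have "(\<integral>\<^sup>+g. indicator {g. through a j l (jump_path n g)} g \<partial>gapM n) =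
         (\<integral>\<^sup>+u. (\<integral>\<^sup>+g. indicator {g. through a j l (jump_path n g)} (g(m := u)) \<partial>gapM m)
           * indicator {0<..} u \<partial>lborel)"
        unfolding m
        by (intro gapM_nn_integral_Suc borel_measurable_indicator_pred measurable_through) (auto intro: gapM_component)
      also have "\<dots> = (\<integral>\<^sup>+u. ennreal (cyl_vol s v l') *
          (ennreal ((s - a - u) ^ d / fact d) * indicator {0..s - a} u) \<partial>lborel)"
      proof (intro nn_integral_cong_AE, rule AE_mp[OF AE_lborel_singleton[of 0]], intro AE_I2 impI)
        fix u :: real assume "u \<noteq> 0"
        show "(\<integral>\<^sup>+g. indicator {g. through a j l (jump_path n g)} (g(m := u)) \<partial>gapM m) * indicator {0<..} u =
          ennreal (cyl_vol s v l') * (ennreal ((s - a - u) ^ d / fact d) * indicator {0..s - a} u)"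
        proof (cases "0 < u")
          case True
          then show ?thesis by (simp only: inner) simp
        next
          case False
          then show ?thesis using \<open>u \<noteq> 0\<close> by simp
        qed
      qed
      also have "\<dots> = ennreal (cyl_vol s v l') *
          (\<integral>\<^sup>+u. ennreal ((s - a - u) ^ d / fact d) * indicator {0..s - a} u \<partial>lborel)"
        by (rule nn_integral_cmult) measurable
      also have "\<dots> = ennreal (cyl_vol s v l') * ennreal ((s - a - 0) ^ Suc d / fact (Suc d))"
        using nn_integral_power_fact[of 0 "s - a" d] as by simp
      also have "\<dots> = ennreal (cyl_vol s v l' * ((s - a - 0) ^ Suc d / fact (Suc d)))"
        using C as by (intro ennreal_mult[symmetric]) auto
      also have "cyl_vol s v l' * ((s - a - 0) ^ Suc d / fact (Suc d)) = cyl_vol a j l"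
        using d by (simp add: l)
      finally show ?thesis .
    qed
  qed
qed

section \<open>From finitely many times to the law of the path\<close>

abbreviation path_space :: "real \<Rightarrow> (real \<Rightarrow> nat) measure" where
  "path_space t \<equiv> \<Pi>\<^sub>M s\<in>{0..t}. count_space UNIV"

text \<open>Times are strict here because the Poisson increments are specified along strictly
  increasing times.\<close>

abbreviation strict_grid :: "(real \<times> nat) list \<Rightarrow> bool" where
  "strict_grid \<equiv> sorted_wrt (\<lambda>p q. fst p < fst q \<and> snd p \<le> snd q)"

lemma measurable_at_times:
  assumes "\<And>s. s \<in> J \<Longrightarrow> (\<lambda>\<omega>. X \<omega> s) \<in> measurable M (count_space UNIV)" "finite J"
  shows "{\<omega>\<in>space M. \<forall>s\<in>J. X \<omega> s = (w s :: nat)} \<in> sets M"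
proof -
  have "{\<omega>\<in>space M. X \<omega> s = w s} \<in> sets M" if "s \<in> J" for s
  proof -
    have [measurable]: "(\<lambda>\<omega>. X \<omega> s) \<in> measurable M (count_space UNIV)" using assms(1) that .
    show ?thesis by measurable
  qed
  then show ?thesis using assms(2) by (intro sets.sets_Collect_finite_All) auto
qed

text \<open>The bound \<open>n\<close> leaves finitely many value assignments \<open>w\<close> on
  \<open>J\<close>, so arbitrary sets \<open>A s\<close> are handled by finite additivity.\<close>

lemma emeasure_path_cylinder:
  fixes X :: "'a \<Rightarrow> real \<Rightarrow> nat"
  assumes meas: "\<And>s. s \<in> {0..t} \<Longrightarrow> (\<lambda>\<omega>. X \<omega> s) \<in> measurable M (count_space UNIV)"
    and bound: "\<And>\<omega> s. \<omega> \<in> space M \<Longrightarrow> s \<in> {0..t} \<Longrightarrow> X \<omega> s \<le> n"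
    and J: "finite J" "J \<subseteq> {0..t}"
  shows "emeasure (distr M (path_space t) (\<lambda>\<omega>. restrict (X \<omega>) {0..t}))
       (prod_emb {0..t} (\<lambda>_. count_space UNIV) J (Pi\<^sub>E J A)) =
     (\<Sum>w\<in>(\<Pi>\<^sub>E s\<in>J. A s \<inter> {..n}). emeasure M {\<omega>\<in>space M. \<forall>s\<in>J. X \<omega> s = w s})"
proof -
  let ?W = "\<Pi>\<^sub>E s\<in>J. A s \<inter> {..n}" and ?E = "\<lambda>w. {\<omega>\<in>space M. \<forall>s\<in>J. X \<omega> s = w s}"
  have r: "(\<lambda>\<omega>. restrict (X \<omega>) {0..t}) \<in> measurable M (path_space t)"
    using meas by (intro measurable_restrict)
  have "emeasure (distr M (path_space t) (\<lambda>\<omega>. restrict (X \<omega>) {0..t}))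
       (prod_emb {0..t} (\<lambda>_. count_space UNIV) J (Pi\<^sub>E J A)) =
     emeasure M ((\<lambda>\<omega>. restrict (X \<omega>) {0..t}) -` prod_emb {0..t} (\<lambda>_. count_space UNIV) J (Pi\<^sub>E J A) \<inter> space M)"
    using J by (intro emeasure_distr r sets_PiM_I) auto
  also have "(\<lambda>\<omega>. restrict (X \<omega>) {0..t}) -` prod_emb {0..t} (\<lambda>_. count_space UNIV) J (Pi\<^sub>E J A) \<inter> space M =
      (\<Union>w\<in>?W. ?E w)"
  proof (intro set_eqI iffI)
    fix \<omega> assume \<omega>: "\<omega> \<in> (\<lambda>\<omega>. restrict (X \<omega>) {0..t}) -` prod_emb {0..t} (\<lambda>_. count_space UNIV) J (Pi\<^sub>E J A) \<inter> space M"
    then have "restrict (X \<omega>) J \<in> ?W" "\<omega> \<in> ?E (restrict (X \<omega>) J)"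
      using J bound by (auto simp: prod_emb_def PiE_iff subset_iff restrict_restrict)
    then show "\<omega> \<in> (\<Union>w\<in>?W. ?E w)" by blast
  next
    fix \<omega> assume "\<omega> \<in> (\<Union>w\<in>?W. ?E w)"
    then show "\<omega> \<in> (\<lambda>\<omega>. restrict (X \<omega>) {0..t}) -` prod_emb {0..t} (\<lambda>_. count_space UNIV) J (Pi\<^sub>E J A) \<inter> space M"
      using J by (auto simp: prod_emb_def PiE_iff subset_iff restrict_def extensional_def)
  qed
  also have "emeasure M (\<Union>w\<in>?W. ?E w) = (\<Sum>w\<in>?W. emeasure M (?E w))"
  proof (rule sum_emeasure[symmetric])
    show "?E ` ?W \<subseteq> sets M" using J meas by (auto intro!: measurable_at_times)
    show "finite ?W" using J by (intro finite_PiE) auto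
    show "disjoint_family_on ?E ?W"
      unfolding disjoint_family_on_def by (auto simp: PiE_iff extensional_def fun_eq_iff; metis)
  qed
  finally show ?thesis .
qed

text \<open>The times 0 and \<open>t\<close> are added with their forced values. Either the
  prescribed values contradict these or monotonicity, and no path fits, or sorting the times gives a
  grid.\<close>

lemma paths_at_times_eq_grid:
  fixes w :: "real \<Rightarrow> nat"
  assumes t: "0 < t" and J: "finite J" "J \<subseteq> {0..t}"
  obtains (impossible) "\<And>f. mono_on {0..t} f \<Longrightarrow> f 0 = 0 \<Longrightarrow> f t = n \<Longrightarrow> \<not> (\<forall>s\<in>J. f s = w s)"
  | (grid) l where "strict_grid ((0, 0) # l)" "last ((0, 0) # l) = (t, n)"
      "\<And>f. mono_on {0..t} f \<Longrightarrow> f 0 = 0 \<Longrightarrow> f t = n \<Longrightarrow> (\<forall>s\<in>J. f s = w s) \<longleftrightarrow> (\<forall>p\<in>set l. f (fst p) = snd p)"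
proof -
  define w' where "w' = w(0 := 0, t := n)"
  define K where "K = insert 0 (insert t J)"
  have K: "finite K" "K \<subseteq> {0..t}" using J t by (auto simp: K_def)
  show thesis
  proof (cases "(\<forall>s\<in>J. w s = w' s) \<and> mono_on K w'")
    case False
    have "\<not> (\<forall>s\<in>J. f s = w s)" if f: "mono_on {0..t} f" "f 0 = 0" "f t = n" for f
    proof
      assume "\<forall>s\<in>J. f s = w s"
      then have fK: "\<forall>s\<in>K. f s = w' s" and "\<forall>s\<in>J. w s = w' s"
        using f t by (auto simp: K_def w'_def)
      moreover have "mono_on K w'"
        using mono_on_subset[OF f(1) K(2)] fK by (simp add: mono_on_def)
      ultimately show False using False by blast
    qed
    then show thesis by (rule impossible)
  next
    case True
    define xs where "xs = sorted_list_of_set (K - {0})"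
    have xs: "set xs = K - {0}" "sorted_wrt (<) xs" using K by (simp_all add: xs_def)
    define l where "l = map (\<lambda>s. (s, w' s)) xs"
    have l: "set l = (\<lambda>s. (s, w' s)) ` (K - {0})" by (simp add: l_def xs)
    have mono: "mono_on K w'" using True by blast
    have "sorted_wrt (\<lambda>s r. s < r \<and> w' s \<le> w' r) xs"
      using xs(2) by (rule sorted_wrt_mono_rel[rotated])
        (use mono xs(1) in \<open>auto simp: mono_on_def\<close>)
    then have "strict_grid l" by (simp add: l_def sorted_wrt_map)
    then have 1: "strict_grid ((0, 0) # l)" using K(2) by (auto simp: l)
    have "t \<in> set xs" using t by (simp add: xs K_def)
    then have ne: "xs \<noteq> []" by auto
    have "last xs = t"
    proof (rule antisym)
      show "last xs \<le> t" using last_in_set[OF ne] xs(1) K(2) by auto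
      obtain i where i: "i < length xs" "t = xs ! i" using \<open>t \<in> set xs\<close> by (metis in_set_conv_nth)
      have "sorted xs" using xs(2) by (simp add: strict_sorted_imp_sorted)
      then show "t \<le> last xs" using i ne by (simp add: last_conv_nth sorted_nth_mono)
    qed
    then have 2: "last ((0, 0) # l) = (t, n)" using ne by (simp add: l_def last_map w'_def)
    have 3: "(\<forall>s\<in>J. f s = w s) \<longleftrightarrow> (\<forall>p\<in>set l. f (fst p) = snd p)"
      if "mono_on {0..t} f" "f 0 = 0" "f t = n" for f
    proof -
      have "(\<forall>s\<in>J. f s = w s) \<longleftrightarrow> (\<forall>s\<in>J. f s = w' s)" using True by auto
      also have "\<dots> \<longleftrightarrow> (\<forall>s\<in>K - {0}. f s = w' s)"
        using that t by (auto simp: K_def w'_def)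
      also have "\<dots> \<longleftrightarrow> (\<forall>p\<in>set l. f (fst p) = snd p)" by (simp add: l)
      finally show ?thesis .
    qed
    show thesis using 1 2 3 by (rule grid)
  qed
qed

text \<open>Cylinders generate the product sigma-algebra and are closed under intersection, so a
  finite measure is determined by them; the two preceding lemmas reduce each cylinder to
  grids.\<close>

lemma path_law_eqI:
  fixes X :: "'a \<Rightarrow> real \<Rightarrow> nat" and Y :: "'b \<Rightarrow> real \<Rightarrow> nat"
  assumes t: "0 < t"
    and X: "\<And>s. s \<in> {0..t} \<Longrightarrow> (\<lambda>\<omega>. X \<omega> s) \<in> measurable M (count_space UNIV)"
      "\<And>\<omega>. \<omega> \<in> space M \<Longrightarrow> mono_on {0..t} (X \<omega>) \<and> X \<omega> 0 = 0 \<and> X \<omega> t = n"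
    and Y: "\<And>s. s \<in> {0..t} \<Longrightarrow> (\<lambda>\<omega>. Y \<omega> s) \<in> measurable M' (count_space UNIV)"
      "\<And>\<omega>. \<omega> \<in> space M' \<Longrightarrow> mono_on {0..t} (Y \<omega>) \<and> Y \<omega> 0 = 0 \<and> Y \<omega> t = n"
    and fin: "finite_measure M"
    and eq: "\<And>l. strict_grid ((0, 0) # l) \<Longrightarrow> last ((0, 0) # l) = (t, n) \<Longrightarrow>
      emeasure M {\<omega>\<in>space M. \<forall>p\<in>set l. X \<omega> (fst p) = snd p} =
      emeasure M' {\<omega>\<in>space M'. \<forall>p\<in>set l. Y \<omega> (fst p) = snd p}"
  shows "distr M (path_space t) (\<lambda>\<omega>. restrict (X \<omega>) {0..t}) =
    distr M' (path_space t) (\<lambda>\<omega>. restrict (Y \<omega>) {0..t})" (is "?P = ?Q")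
proof (rule measure_eqI_PiM_infinite)
  show "sets ?P = sets (path_space t)" "sets ?Q = sets (path_space t)" by simp_all
  show "finite_measure ?P"
    using fin X(1) by (intro finite_measure.finite_measure_distr measurable_restrict)
  fix A :: "real \<Rightarrow> nat set" and J
  assume J: "finite J" "J \<subseteq> {0..t}"
  let ?E = "prod_emb {0..t} (\<lambda>_. count_space UNIV) J (Pi\<^sub>E J A)" and ?W = "\<Pi>\<^sub>E s\<in>J. A s \<inter> {..n}"
  have PX: "emeasure ?P ?E = (\<Sum>w\<in>?W. emeasure M {\<omega>\<in>space M. \<forall>s\<in>J. X \<omega> s = w s})"
  proof (rule emeasure_path_cylinder[OF _ _ J])
    fix \<omega> s assume "\<omega> \<in> space M" "s \<in> {0..t}"
    then show "X \<omega> s \<le> n" using X(2)[of \<omega>] t by (auto dest!: mono_onD[of _ "X \<omega>" s t])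
  qed (rule X(1))
  have PY: "emeasure ?Q ?E = (\<Sum>w\<in>?W. emeasure M' {\<omega>\<in>space M'. \<forall>s\<in>J. Y \<omega> s = w s})"
  proof (rule emeasure_path_cylinder[OF _ _ J])
    fix \<omega> s assume "\<omega> \<in> space M'" "s \<in> {0..t}"
    then show "Y \<omega> s \<le> n" using Y(2)[of \<omega>] t by (auto dest!: mono_onD[of _ "Y \<omega>" s t])
  qed (rule Y(1))
  have "emeasure M {\<omega>\<in>space M. \<forall>s\<in>J. X \<omega> s = w s} = emeasure M' {\<omega>\<in>space M'. \<forall>s\<in>J. Y \<omega> s = w s}" for w
  proof (cases rule: paths_at_times_eq_grid[OF t J, where n = n and w = w, case_names impossible grid])
    case impossible
    then have "{\<omega>\<in>space M. \<forall>s\<in>J. X \<omega> s = w s} = {}" "{\<omega>\<in>space M'. \<forall>s\<in>J. Y \<omega> s = w s} = {}"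
      using X(2) Y(2) by blast+
    then show ?thesis by (simp only: emeasure_empty)
  next
    case (grid l)
    have "{\<omega>\<in>space M. \<forall>s\<in>J. X \<omega> s = w s} = {\<omega>\<in>space M. \<forall>p\<in>set l. X \<omega> (fst p) = snd p}"
      using grid(3) X(2) by (intro Collect_cong conj_cong refl) blast
    moreover have "{\<omega>\<in>space M'. \<forall>s\<in>J. Y \<omega> s = w s} = {\<omega>\<in>space M'. \<forall>p\<in>set l. Y \<omega> (fst p) = snd p}"
      using grid(3) Y(2) by (intro Collect_cong conj_cong refl) blast
    ultimately show ?thesis using eq[OF grid(1,2)] by simp
  qed
  then show "emeasure ?P ?E = emeasure ?Q ?E"
    unfolding PX PY by (intro sum.cong refl)
qed

subsection \<open>The displacement as a measurable functional on the product space\<close>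

text \<open>The sample points tend to \<open>r\<close> strictly from the right, so a right-continuous path is recovered in
  the limit, while each approximation depends on countably many coordinates only.\<close>

definition sample_point :: "real \<Rightarrow> nat \<Rightarrow> real \<Rightarrow> real" where
  "sample_point t m r = max 0 (min t ((of_int \<lfloor>real (Suc m) * r\<rfloor> + 1) / real (Suc m)))"

definition path_sign :: "real \<Rightarrow> (real \<Rightarrow> nat) \<Rightarrow> real \<Rightarrow> real" where
  "path_sign t f r = lim (\<lambda>m. (- 1) ^ f (sample_point t m r))"

definition path_integral :: "real \<Rightarrow> (real \<Rightarrow> nat) \<Rightarrow> real \<Rightarrow> real" where
  "path_integral t f s = (LINT r:{0..s}|lborel. path_sign t f r)"

text \<open>Rational times keep the set measurable; for right-continuous monotone paths the
  displacement is continuous, so nothing is lost.\<close>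

definition nonneg_paths :: "real \<Rightarrow> (real \<Rightarrow> nat) set" where
  "nonneg_paths t = {f\<in>space (path_space t). \<forall>q\<in>\<rat> \<inter> {0..t}. 0 \<le> path_integral t f q}"

text \<open>Joint measurability is what allows integration over \<open>r\<close>. For each value of
  the floor the sampled coordinate is fixed, and countably many such pieces are glued.\<close>

lemma measurable_path_sign:
  assumes "0 \<le> t"
  shows "(\<lambda>(f, r). path_sign t f r) \<in> borel_measurable (path_space t \<Otimes>\<^sub>M borel)"
proof -
  have "(\<lambda>p. (- 1 :: real) ^ fst p (sample_point t m (snd p))) \<in> borel_measurable (path_space t \<Otimes>\<^sub>M borel)" for m
  proof -
    let ?x = "\<lambda>i::int. max 0 (min t ((of_int i + 1) / real (Suc m)))"
    have "(\<lambda>p. (- 1 :: real) ^ fst p (?x i)) \<in> borel_measurable (path_space t \<Otimes>\<^sub>M borel)" for i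
    proof -
      have "(\<lambda>f. f (?x i)) \<in> measurable (path_space t) (count_space UNIV)"
        using assms by (intro measurable_component_singleton) auto
      from measurable_compose[OF measurable_compose[OF measurable_fst this], of "\<lambda>n. (- 1 :: real) ^ n" borel borel]
      show ?thesis by simp
    qed
    then have "(\<lambda>p. (- 1 :: real) ^ fst p (?x \<lfloor>real (Suc m) * snd p\<rfloor>)) \<in> borel_measurable (path_space t \<Otimes>\<^sub>M borel)"
      by (rule measurable_compose_countable) measurable
    then show ?thesis unfolding sample_point_def .
  qed
  then show ?thesis unfolding path_sign_def case_prod_beta by (rule borel_measurable_lim_metric)
qed

lemma sets_nonneg_paths:
  assumes "0 \<le> t"
  shows "nonneg_paths t \<in> sets (path_space t)"
proof -
  have [measurable]: "(\<lambda>(f, r). path_sign t f r) \<in> borel_measurable (path_space t \<Otimes>\<^sub>M lborel)"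
    using measurable_path_sign[OF assms] by simp
  have [measurable]: "(\<lambda>f. path_integral t f s) \<in> borel_measurable (path_space t)" for s
    unfolding path_integral_def set_lebesgue_integral_def by measurable
  have "nonneg_paths t = {f\<in>space (path_space t). \<forall>q::rat. of_rat q \<in> {0..t} \<longrightarrow> 0 \<le> path_integral t f (of_rat q)}"
    by (auto simp: nonneg_paths_def Rats_def)
  also have "\<dots> \<in> sets (path_space t)" by measurable
  finally show ?thesis .
qed

lemma path_sign_eq:
  assumes f: "\<And>r. 0 \<le> r \<Longrightarrow> eventually (\<lambda>s. f s = f r) (at_right r)" and r: "r \<in> {0..t}"
  shows "path_sign t (restrict f {0..t}) r = (- 1) ^ f r"
proof -
  let ?y = "\<lambda>m. (of_int \<lfloor>real (Suc m) * r\<rfloor> + 1) / real (Suc m)"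
  have y: "r < ?y m" "?y m \<le> r + 1 / real (Suc m)" for m
    by (simp_all add: field_simps del: of_nat_Suc) (linarith | simp)+
  have "eventually (\<lambda>m. f (sample_point t m r) = f r) sequentially"
  proof (cases "r = t")
    \<comment> \<open>There is no coordinate to the right of \<open>t\<close>; clipping by
      \<open>min t\<close> returns \<open>t\<close> itself.\<close>
    case True
    then have "sample_point t m r = r" for m
      using y(1)[of m] r by (simp add: sample_point_def)
    then show ?thesis by simp
  next
    case False
    then have rt: "r < t" using r by simp
    have "?y \<longlonglongrightarrow> r"
    proof (rule tendsto_sandwich)
      show "(\<lambda>m. r) \<longlonglongrightarrow> r" by simp
      show "(\<lambda>m. r + 1 / real (Suc m)) \<longlonglongrightarrow> r"
        using tendsto_add[OF tendsto_const[of r] LIMSEQ_inverse_real_of_nat]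
        by (simp add: inverse_eq_divide)
    qed (intro always_eventually allI less_imp_le[OF y(1)] y(2))+
    then have "filterlim ?y (at_right r) sequentially"
      using y(1) by (intro tendsto_imp_filterlim_at_right always_eventually allI)
    have 1: "eventually (\<lambda>m. f (?y m) = f r) sequentially"
      using eventually_compose_filterlim[OF f[of r] \<open>filterlim ?y (at_right r) sequentially\<close>] r by simp
    have 2: "eventually (\<lambda>m. ?y m < t) sequentially"
      using \<open>?y \<longlonglongrightarrow> r\<close> rt by (rule order_tendstoD)
    show ?thesis using 1 2
    proof eventually_elim
      case (elim m)
      moreover have "0 \<le> ?y m" using y(1)[of m] r by simp
      ultimately show ?case by (simp add: sample_point_def)
    qed
  qed
  moreover have "sample_point t m r \<in> {0..t}" for m using r by (auto simp: sample_point_def)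
  ultimately have "eventually (\<lambda>m. (- 1 :: real) ^ restrict f {0..t} (sample_point t m r) = (- 1) ^ f r) sequentially"
    by (auto elim!: eventually_mono)
  then show ?thesis unfolding path_sign_def by (intro limI tendsto_eventually)
qed

lemma path_integral_eq:
  assumes f: "\<And>r. 0 \<le> r \<Longrightarrow> eventually (\<lambda>s. f s = f r) (at_right r)" and s: "s \<le> t" "0 \<le> t"
  shows "path_integral t (restrict f {0..t}) s = integral {0..s} (\<lambda>r. (- 1) ^ f r)"
proof -
  let ?g = "path_sign t (restrict f {0..t})"
  have eq: "?g r = (- 1) ^ f r" if "r \<in> {0..s}" for r
    using that s by (intro path_sign_eq[OF f]) auto
  have "restrict f {0..t} \<in> space (path_space t)" by (simp add: space_PiM)
  then have m: "?g \<in> borel_measurable lborel"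
    using measurable_compose[OF measurable_Pair1' measurable_path_sign[OF s(2)], of "restrict f {0..t}"] by simp
  have "set_integrable lborel {0..s} ?g"
    unfolding set_integrable_def
    by (rule integrableI_bounded_set_indicator[where B = 1])
      (use m eq in \<open>auto simp: power_abs emeasure_lborel_Icc_eq\<close>)
  then have "path_integral t (restrict f {0..t}) s = integral {0..s} ?g"
    unfolding path_integral_def by (rule set_borel_integral_eq_integral(2))
  also have "\<dots> = integral {0..s} (\<lambda>r. (- 1) ^ f r)"
    using eq by (intro Henstock_Kurzweil_Integration.integral_cong)
  finally show ?thesis .
qed

lemma nonneg_on_rationals:
  fixes F :: "real \<Rightarrow> real"
  assumes "continuous_on {0..t} F" "\<forall>q\<in>\<rat> \<inter> {0..t}. 0 \<le> F q" "s \<in> {0..t}"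
  shows "0 \<le> F s"
proof (rule ccontr)
  assume neg: "\<not> 0 \<le> F s"
  then have "s \<noteq> 0" using assms by auto
  then have s: "0 < s" using assms(3) by auto
  obtain d where d: "0 < d" "\<And>r. r \<in> {0..t} \<Longrightarrow> dist r s < d \<Longrightarrow> dist (F r) (F s) < - F s"
    using assms(1,3) neg unfolding continuous_on_iff by (metis neg_0_less_iff_less not_le)
  \<comment> \<open>Approximation from the left stays inside the interval even when
    \<open>s = t\<close>; the point 0 is itself rational.\<close>
  obtain q where q: "q \<in> \<rat>" "max 0 (s - d) < q" "q < s"
    using Rats_dense_in_real[of "max 0 (s - d)" s] s d(1) by auto
  then have "q \<in> {0..t}" "dist q s < d" using assms(3) by (auto simp: dist_real_def)
  then have "dist (F q) (F s) < - F s" "0 \<le> F q" using d(2) assms(2) q(1) by auto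
  then show False by (simp add: dist_real_def)
qed

text \<open>Applied to Poisson paths and to \<open>jump_path\<close> alike, this lets equality of
  the path laws carry over to the event about all times.\<close>

lemma restrict_in_nonneg_paths_iff:
  assumes f: "\<And>r. 0 \<le> r \<Longrightarrow> eventually (\<lambda>s. f s = f r) (at_right r)"
    and mono: "mono_on {0..} f" and t: "0 \<le> t"
  shows "restrict f {0..t} \<in> nonneg_paths t \<longleftrightarrow> (\<forall>s\<in>{0..t}. 0 \<le> integral {0..s} (\<lambda>r. (- 1 :: real) ^ f r))"
proof -
  let ?F = "\<lambda>s. integral {0..s} (\<lambda>r. (- 1 :: real) ^ f r)"
  have "continuous_on {0..t} ?F"
    by (rule indefinite_integral_continuous_1[OF signed_path_integrable[OF mono]])
  then have "(\<forall>q\<in>\<rat> \<inter> {0..t}. 0 \<le> ?F q) \<longleftrightarrow> (\<forall>s\<in>{0..t}. 0 \<le> ?F s)"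
    using nonneg_on_rationals by blast
  then show ?thesis
    using path_integral_eq[of f _ t, OF f _ t] by (simp add: nonneg_paths_def space_PiM)
qed

section \<open>Poisson probabilities of grids and of nonnegative displacement\<close>

lemma prod_poisson_increments:
  assumes "0 < r" "strict_grid ((a, j) # l)"
  shows "(\<Prod>i<length l. pmf (poisson_pmf (r * (fst (l ! i) - fst (((a, j) # l) ! i))))
      (snd (l ! i) - snd (((a, j) # l) ! i))) =
    exp (- r * (fst (last ((a, j) # l)) - a)) * r ^ (snd (last ((a, j) # l)) - j) * cyl_vol a j l"
  using assms
proof (induction l arbitrary: a j)
  case (Cons p l)
  obtain s v where p: "p = (s, v)" by (cases p)
  define S W where "S = fst (last (p # l))" and "W = snd (last (p # l))"
  have as: "a < s" "j \<le> v" and srt: "strict_grid ((s, v) # l)" using Cons.prems by (auto simp: p)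
  have "v \<le> W"
    using srt last_in_set[of l] by (auto simp: W_def p)
  \<comment> \<open>The powers of \<open>r\<close> and the exponentials telescope, so apart from
    \<open>cyl_vol\<close> only the end point of the grid matters.\<close>
  then have pw: "r ^ (v - j) * r ^ (W - v) = r ^ (W - j)"
    using as by (simp add: power_add[symmetric])
  have ex: "exp (- r * (s - a)) * exp (- r * (S - s)) = exp (- r * (S - a))"
    by (simp add: exp_add[symmetric] algebra_simps)
  have "0 < r * (s - a)" using Cons.prems as by simp
  note pmf = pmf_poisson[OF this, of "v - j"]
  have "(\<Prod>i<length (p # l). pmf (poisson_pmf (r * (fst ((p # l) ! i) - fst (((a, j) # p # l) ! i))))
      (snd ((p # l) ! i) - snd (((a, j) # p # l) ! i))) =
    pmf (poisson_pmf (r * (s - a))) (v - j) *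
    (\<Prod>i<length l. pmf (poisson_pmf (r * (fst (l ! i) - fst ((p # l) ! i))))
      (snd (l ! i) - snd ((p # l) ! i)))"
    unfolding length_Cons prod.lessThan_Suc_shift by (simp add: p)
  also have "\<dots> = ((r * (s - a)) ^ (v - j) / fact (v - j) * exp (- (r * (s - a)))) *
      (exp (- r * (S - s)) * r ^ (W - v) * cyl_vol s v l)"
    using Cons.IH[OF Cons.prems(1) srt] unfolding pmf by (simp add: p S_def W_def)
  also have "\<dots> = (exp (- r * (s - a)) * exp (- r * (S - s))) * (r ^ (v - j) * r ^ (W - v)) * cyl_vol a j (p # l)"
    by (simp add: p power_mult_distrib)
  finally show ?case unfolding pw ex by (simp add: S_def W_def)
qed simp

context prob_space
begin

lemma
  assumes "homogeneous_poisson_process r N"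
  shows poisson_process_measurable: "0 \<le> s \<Longrightarrow> N s \<in> measurable M (count_space UNIV)"
    and poisson_process_0: "\<omega> \<in> space M \<Longrightarrow> N 0 \<omega> = 0"
    and poisson_process_mono: "\<omega> \<in> space M \<Longrightarrow> mono_on {0..} (\<lambda>s. N s \<omega>)"
    and poisson_process_right_const:
      "\<omega> \<in> space M \<Longrightarrow> 0 \<le> s \<Longrightarrow> eventually (\<lambda>q. N q \<omega> = N s \<omega>) (at_right s)"
  using assms unfolding homogeneous_poisson_process_def by (auto simp: tendsto_discrete)

lemma poisson_process_grid:
  assumes N: "homogeneous_poisson_process r N" and r: "0 < r" and l: "strict_grid ((0, 0) # l)"
  shows "prob {\<omega>\<in>space M. \<forall>p\<in>set l. N (fst p) \<omega> = snd p} =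
    exp (- r * fst (last ((0, 0) # l))) * r ^ snd (last ((0, 0) # l)) * cyl_vol 0 0 l"
proof (cases "l = []")
  \<comment> \<open>Separate because an intersection over no increments would be \<open>UNIV\<close>
    instead of \<open>space M\<close>.\<close>
  case True
  then show ?thesis by (simp add: prob_space)
next
  case False
  let ?L = "(0, 0) # l"
  let ?n = "length l"
  define T where "T i = fst (?L ! i)" for i
  define v where "v i = snd (?L ! i)" for i
  have step: "T i < T (Suc i)" "v i \<le> v (Suc i)" if "i < ?n" for i
    using sorted_wrt_nth_less[OF l, of i "Suc i"] that by (simp_all add: T_def v_def)
  have T0: "T 0 = 0" "v 0 = 0" by (simp_all add: T_def v_def)
  have T_nonneg: "0 \<le> T i" if "i \<le> ?n" for i
    using that
  proof (induction i)
    case (Suc i)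
    then show ?case using step(1)[of i] by simp
  qed (simp add: T0)
  let ?X = "\<lambda>i \<omega>. N (T (Suc i)) \<omega> - N (T i) \<omega>"
  have ind: "indep_vars (\<lambda>_. count_space UNIV) ?X {..<?n}"
    using N step(1) T0 unfolding homogeneous_poisson_process_def by simp
  have "{\<omega>\<in>space M. \<forall>p\<in>set l. N (fst p) \<omega> = snd p} = (\<Inter>i\<in>{..<?n}. ?X i -` {v (Suc i) - v i} \<inter> space M)"
    (is "?A = ?B")
  proof (intro set_eqI iffI)
    fix \<omega> assume \<omega>: "\<omega> \<in> ?A"
    have "N (T i) \<omega> = v i" if "i \<le> ?n" for i
    proof (cases i)
      case 0
      then show ?thesis using \<omega> poisson_process_0[OF N] T0 by simp
    next
      case (Suc k)
      then have "?L ! i \<in> set l" using that by simp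
      then show ?thesis using \<omega> by (simp add: T_def v_def)
    qed
    then show "\<omega> \<in> ?B" using \<omega> by (auto simp: Suc_le_eq)
  next
    fix \<omega> assume B: "\<omega> \<in> ?B"
    have *: "\<omega> \<in> ?X i -` {v (Suc i) - v i} \<inter> space M" if "i < ?n" for i
      by (rule INT_D[OF B]) (use that in simp)
    then have inc: "\<And>i. i < ?n \<Longrightarrow> ?X i \<omega> = v (Suc i) - v i" by blast
    have \<omega>: "\<omega> \<in> space M" using *[of 0] False by simp
    have Nv: "N (T i) \<omega> = v i" if "i \<le> ?n" for i
      using that
    proof (induction i)
      case 0
      then show ?case using \<omega> poisson_process_0[OF N] T0 by simp
    next
      case (Suc i)
      \<comment> \<open>Subtraction on \<open>nat\<close> is truncated; monotonicity makes the
        increment determine the next value.\<close>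
      have "N (T i) \<omega> \<le> N (T (Suc i)) \<omega>"
        using Suc.prems T_nonneg[of i] T_nonneg[of "Suc i"] step(1)[of i]
        by (intro mono_onD[OF poisson_process_mono[OF N \<omega>]]) auto
      then show ?case using inc[of i] step(2)[of i] Suc by simp
    qed
    have "N (fst p) \<omega> = snd p" if "p \<in> set l" for p
    proof -
      obtain i where "i < ?n" "p = l ! i" using \<open>p \<in> set l\<close> by (metis in_set_conv_nth)
      then show ?thesis using Nv[of "Suc i"] by (simp add: T_def v_def)
    qed
    then show "\<omega> \<in> ?A" using \<omega> by blast
  qed
  then have "prob ?A = (\<Prod>i\<in>{..<?n}. prob (?X i -` {v (Suc i) - v i} \<inter> space M))"
    using indep_varsD_finite[OF ind, of "\<lambda>i. {v (Suc i) - v i}"] False by (simp only:) auto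
  also have "\<dots> = (\<Prod>i<?n. pmf (poisson_pmf (r * (T (Suc i) - T i))) (v (Suc i) - v i))"
  proof (rule prod.cong[OF refl])
    fix i assume "i \<in> {..<?n}"
    then have i: "i < ?n" "0 \<le> T i" "T i < T (Suc i)" using T_nonneg[of i] step(1)[of i] by auto
    have "?X i \<in> measurable M (count_space UNIV)"
      using ind i unfolding indep_vars_def by auto
    from measure_distr[OF this, of "{v (Suc i) - v i}"]
    have "prob (?X i -` {v (Suc i) - v i} \<inter> space M) =
        measure (distr M (count_space UNIV) (?X i)) {v (Suc i) - v i}" by simp
    also have "distr M (count_space UNIV) (?X i) = measure_pmf (poisson_pmf (r * (T (Suc i) - T i)))"
      using N i unfolding homogeneous_poisson_process_def by simp
    finally show "prob (?X i -` {v (Suc i) - v i} \<inter> space M) =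
        pmf (poisson_pmf (r * (T (Suc i) - T i))) (v (Suc i) - v i)"
      by (simp add: measure_pmf_single)
  qed
  also have "\<dots> = exp (- r * fst (last ?L)) * r ^ snd (last ?L) * cyl_vol 0 0 l"
    using prod_poisson_increments[OF r l] by (simp add: T_def v_def)
  finally show ?thesis .
qed

text \<open>On grids ending in \<open>(t, n)\<close> the Poisson probability is
  \<open>cyl_vol\<close> times a factor free of the grid. Scaling the gap measure by this factor
  therefore gives the unnormalised law of the path on \<open>N t = n\<close>.\<close>

lemma poisson_process_path_law:
  assumes N: "homogeneous_poisson_process r N" and r: "0 < r" and t: "0 < t"
    and A: "A \<in> sets (path_space t)"
  shows "emeasure M {\<omega>\<in>space M. restrict (\<lambda>s. N s \<omega>) {0..t} \<in> A \<and> N t \<omega> = n} =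
    ennreal (exp (- r * t) * r ^ n) *
    emeasure (gapM n) {g\<in>space (gapM n). restrict (jump_path n g) {0..t} \<in> A \<and> jump_path n g t = n}"
proof -
  let ?C = "ennreal (exp (- r * t) * r ^ n)"
  let ?W = "{\<omega>\<in>space M. N t \<omega> = n}" and ?G = "{g\<in>space (gapM n). jump_path n g t = n}"
  let ?P = "restrict_space M ?W" and ?Q = "scale_measure ?C (restrict_space (gapM n) ?G)"
  have jp [measurable]: "(\<lambda>g. jump_path n g s) \<in> measurable (gapM n) (count_space UNIV)" for s
    by (rule measurable_jump_path) (auto intro: gapM_component)
  have Nt [measurable]: "N t \<in> measurable M (count_space UNIV)"
    using poisson_process_measurable[OF N] t by simp
  have W: "?W \<in> sets M" and G: "?G \<in> sets (gapM n)" by measurable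
  have X: "(\<lambda>\<omega>. N s \<omega>) \<in> measurable ?P (count_space UNIV)" if "s \<in> {0..t}" for s
    using poisson_process_measurable[OF N, of s] that by (intro measurable_restrict_space1) simp
  have Y: "(\<lambda>g. jump_path n g s) \<in> measurable ?Q (count_space UNIV)" for s
    using measurable_restrict_space1[OF jp[of s], of ?G] by (simp cong: measurable_cong_sets)
  have spP: "space ?P = ?W" and spQ: "space ?Q = ?G"
    by (auto simp: space_restrict_space space_scale_measure)
  have emP: "emeasure ?P S = emeasure M S" if "S \<subseteq> ?W" for S
    using W that by (intro emeasure_restrict_space) (auto simp: Int_absorb2)
  have emQ: "emeasure ?Q S = ?C * emeasure (gapM n) S" if "S \<subseteq> ?G" for S
    using G that by (simp add: emeasure_restrict_space Int_absorb2)
  have law: "distr ?P (path_space t) (\<lambda>\<omega>. restrict (\<lambda>s. N s \<omega>) {0..t}) =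
      distr ?Q (path_space t) (\<lambda>g. restrict (jump_path n g) {0..t})"
  proof (rule path_law_eqI[OF t X _ Y])
    show "mono_on {0..t} (\<lambda>s. N s \<omega>) \<and> N 0 \<omega> = 0 \<and> N t \<omega> = n" if "\<omega> \<in> space ?P" for \<omega>
      using that poisson_process_0[OF N] mono_on_subset[OF poisson_process_mono[OF N], of \<omega> "{0..t}"]
      unfolding spP by auto
    show "mono_on {0..t} (jump_path n g) \<and> jump_path n g 0 = 0 \<and> jump_path n g t = n" if "g \<in> space ?Q" for g
      using that mono_on_subset[OF mono_jump_path subset_UNIV] jump_path_nonpos[of n g 0]
      unfolding spQ by (auto simp: space_gapM)
    show "finite_measure ?P" using W by (intro finite_measure_restrict_space) auto
    fix l assume l: "strict_grid ((0, 0) # l)" "last ((0, 0) # l) = (t, n)"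
    then have tn: "(t, n) \<in> set l" using t last_in_set[of l] by (cases "l = []") auto
    have "{\<omega>\<in>space ?P. \<forall>p\<in>set l. N (fst p) \<omega> = snd p} = {\<omega>\<in>space M. \<forall>p\<in>set l. N (fst p) \<omega> = snd p}"
      using tn unfolding spP by force
    moreover have "{\<omega>\<in>space M. \<forall>p\<in>set l. N (fst p) \<omega> = snd p} \<subseteq> ?W" using tn by force
    ultimately have "emeasure ?P {\<omega>\<in>space ?P. \<forall>p\<in>set l. N (fst p) \<omega> = snd p} =
        ennreal (exp (- r * t) * r ^ n * cyl_vol 0 0 l)"
      using poisson_process_grid[OF N r l(1)] l(2) by (simp only: emP) (simp add: emeasure_eq_measure)
    also have "\<dots> = ?C * ennreal (cyl_vol 0 0 l)"
    proof (rule ennreal_mult)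
      have "grid_mono ((0, 0) # l)" using l(1) by (rule sorted_wrt_mono_rel[rotated]) auto
      then show "0 \<le> cyl_vol 0 0 l" by (rule cyl_vol_nonneg)
    qed (use r in simp)
    also have "ennreal (cyl_vol 0 0 l) = emeasure (gapM n) {g\<in>space (gapM n). through 0 0 l (jump_path n g)}"
    proof -
      have "grid_mono ((0, 0) # l)" using l(1) by (rule sorted_wrt_mono_rel[rotated]) auto
      then have "ennreal (cyl_vol 0 0 l) = (\<integral>\<^sup>+g. indicator {g. through 0 0 l (jump_path n g)} g \<partial>gapM n)"
        using l(2) by (intro through_volume[symmetric]) auto
      also have "\<dots> = (\<integral>\<^sup>+g. indicator {g\<in>space (gapM n). through 0 0 l (jump_path n g)} g \<partial>gapM n)"
        by (intro nn_integral_cong) (simp add: indicator_def)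
      also have "\<dots> = emeasure (gapM n) {g\<in>space (gapM n). through 0 0 l (jump_path n g)}"
        using measurable_through[of n "\<lambda>g. g" "gapM n"]
        by (intro nn_integral_indicator) (auto intro: gapM_component simp: pred_def)
      finally show ?thesis .
    qed
    also have "{g\<in>space (gapM n). through 0 0 l (jump_path n g)} =
        {g\<in>space ?Q. \<forall>p\<in>set l. jump_path n g (fst p) = snd p}"
      using tn unfolding spQ through_def by force
    also have "?C * emeasure (gapM n) {g\<in>space ?Q. \<forall>p\<in>set l. jump_path n g (fst p) = snd p} =
        emeasure ?Q {g\<in>space ?Q. \<forall>p\<in>set l. jump_path n g (fst p) = snd p}"
      using spQ by (intro emQ[symmetric]) auto
    finally show "emeasure ?P {\<omega>\<in>space ?P. \<forall>p\<in>set l. N (fst p) \<omega> = snd p} =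
        emeasure ?Q {g\<in>space ?Q. \<forall>p\<in>set l. jump_path n g (fst p) = snd p}" .
  qed
  have "emeasure M {\<omega>\<in>space M. restrict (\<lambda>s. N s \<omega>) {0..t} \<in> A \<and> N t \<omega> = n} =
      emeasure ?P ((\<lambda>\<omega>. restrict (\<lambda>s. N s \<omega>) {0..t}) -` A \<inter> space ?P)"
    unfolding spP by (subst emP) (auto intro!: arg_cong[where f = "emeasure M"])
  also have "\<dots> = emeasure (distr ?P (path_space t) (\<lambda>\<omega>. restrict (\<lambda>s. N s \<omega>) {0..t})) A"
    using X A by (intro emeasure_distr[symmetric] measurable_restrict)
  also have "\<dots> = emeasure ?Q ((\<lambda>g. restrict (jump_path n g) {0..t}) -` A \<inter> space ?Q)"
    unfolding law using Y A by (intro emeasure_distr measurable_restrict)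
  also have "\<dots> = ?C * emeasure (gapM n) ((\<lambda>g. restrict (jump_path n g) {0..t}) -` A \<inter> ?G)"
    unfolding spQ by (intro emQ) auto
  also have "(\<lambda>g. restrict (jump_path n g) {0..t}) -` A \<inter> ?G =
      {g\<in>space (gapM n). restrict (jump_path n g) {0..t} \<in> A \<and> jump_path n g t = n}" by auto
  finally show ?thesis .
qed

text \<open>A start at the barrier moving down means \<open>x = 0\<close>, where both coordinates of
  \<open>stay_vol\<close> equal \<open>t / 2\<close>; this is the source of
  \<open>2 ^ n\<close>.\<close>

lemma prob_nonneg_path:
  assumes N: "homogeneous_poisson_process r N" and r: "0 < r" and t: "0 < t"
  shows "prob {\<omega>\<in>space M. restrict (\<lambda>s. N s \<omega>) {0..t} \<in> nonneg_paths t \<and> N t \<omega> = n} =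
    exp (- r * t) * (r * t) ^ n / fact n * (real (n choose (n div 2)) / 2 ^ n)"
proof -
  let ?S = "{g\<in>space (gapM n). stays n True 0 t g}"
  have vol: "stay_vol n True 0 t = (t / 2) ^ n * real (n choose (n div 2)) / fact n"
    using t signed_binomial_sgn_Suc_diag[of n "t / 2"] by (simp add: stay_vol_def)
  have "{g\<in>space (gapM n). restrict (jump_path n g) {0..t} \<in> nonneg_paths t \<and> jump_path n g t = n} = ?S"
  proof (intro Collect_cong conj_cong refl)
    fix g assume "g \<in> space (gapM n)"
    then have g: "\<forall>i<n. 0 < g i" by (auto simp: space_gapM)
    show "restrict (jump_path n g) {0..t} \<in> nonneg_paths t \<and> jump_path n g t = n \<longleftrightarrow> stays n True 0 t g"
      using stays_iff[OF g, of 0 t True] t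
        restrict_in_nonneg_paths_iff[of "jump_path n g" t, OF jump_path_right_const
          mono_on_subset[OF mono_jump_path subset_UNIV]]
      by auto
  qed
  moreover have "emeasure (gapM n) ?S = ennreal (stay_vol n True 0 t)"
  proof -
    have "?S \<in> sets (gapM n)"
      using measurable_stays[of n "\<lambda>g. g" "gapM n" "\<lambda>_. 0" "\<lambda>_. t" True]
      by (auto intro: gapM_component simp: pred_def)
    then have "emeasure (gapM n) ?S = (\<integral>\<^sup>+g. indicator ?S g \<partial>gapM n)" by simp
    also have "\<dots> = (\<integral>\<^sup>+g. indicator {g. stays n True 0 t g} g \<partial>gapM n)"
      by (intro nn_integral_cong) (simp add: indicator_def)
    finally show ?thesis using stays_volume[of 0 t n True] t by simp
  qed
  moreover have "nonneg_paths t \<in> sets (path_space t)" using t by (simp add: sets_nonneg_paths)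
  ultimately have "emeasure M {\<omega>\<in>space M. restrict (\<lambda>s. N s \<omega>) {0..t} \<in> nonneg_paths t \<and> N t \<omega> = n} =
      ennreal (exp (- r * t) * r ^ n) * ennreal (stay_vol n True 0 t)"
    using poisson_process_path_law[OF N r t, of "nonneg_paths t" n] by simp
  also have "\<dots> = ennreal (exp (- r * t) * r ^ n * stay_vol n True 0 t)"
    using r t vol by (intro ennreal_mult[symmetric]) auto
  finally have "prob {\<omega>\<in>space M. restrict (\<lambda>s. N s \<omega>) {0..t} \<in> nonneg_paths t \<and> N t \<omega> = n} =
      exp (- r * t) * r ^ n * stay_vol n True 0 t"
    using r t vol by (simp add: emeasure_eq_measure)
  then show ?thesis unfolding vol by (simp add: power_mult_distrib power_divide mult_ac)
qed

lemma prob_poisson_count: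
  assumes N: "homogeneous_poisson_process r N" and r: "0 < r" and t: "0 < t"
  shows "prob {\<omega>\<in>space M. N t \<omega> = n} = exp (- r * t) * (r * t) ^ n / fact n"
  using poisson_process_grid[OF N r, of "[(t, n)]"] t by (simp add: power_mult_distrib)

end

subsection \<open>The running maximum\<close>

text \<open>The process starts at 0, so its maximum is 0 exactly if it never becomes positive; the
  speed \<open>c\<close> only scales it.\<close>

lemma running_max_telegraph_eq_0_iff:
  assumes "mono_on {0..} (\<lambda>s. N s \<omega>)" "\<And>r. 0 \<le> r \<Longrightarrow> eventually (\<lambda>s. N s \<omega> = N r \<omega>) (at_right r)"
    and "0 < c" "V \<omega> = - c" "0 \<le> t"
  shows "running_max (telegraph V N) t \<omega> = 0 \<longleftrightarrow> restrict (\<lambda>s. N s \<omega>) {0..t} \<in> nonneg_paths t"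
proof -
  have T: "telegraph V N s \<omega> = - (c * integral {0..s} (\<lambda>r. (- 1) ^ N r \<omega>))" for s
    using assms(4) by (simp add: telegraph_def)
  have T0: "telegraph V N 0 \<omega> = 0" by (simp add: T)
  obtain s where s: "s \<in> {0..t}" "telegraph V N s \<omega> = running_max (telegraph V N) t \<omega>"
    "\<forall>u\<in>{0..t}. telegraph V N u \<omega> \<le> telegraph V N s \<omega>"
    using running_max_telegraph_attained[of N \<omega> t V, OF assms(1,5)] by blast
  have "running_max (telegraph V N) t \<omega> = 0 \<longleftrightarrow> (\<forall>u\<in>{0..t}. telegraph V N u \<omega> \<le> 0)"
  proof
    assume "\<forall>u\<in>{0..t}. telegraph V N u \<omega> \<le> 0"
    then have "telegraph V N s \<omega> \<le> 0" using s(1) by blast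
    moreover have "0 \<le> telegraph V N s \<omega>" using s(3) assms(5) T0 by (auto dest: bspec[of _ _ 0])
    ultimately show "running_max (telegraph V N) t \<omega> = 0" using s(2) by simp
  qed (use s in auto)
  also have "\<dots> \<longleftrightarrow> (\<forall>u\<in>{0..t}. 0 \<le> integral {0..u} (\<lambda>r. (- 1 :: real) ^ N r \<omega>))"
    using assms(3) by (simp add: T zero_le_mult_iff)
  finally show ?thesis
    using restrict_in_nonneg_paths_iff[of "\<lambda>s. N s \<omega>" t, OF assms(2,1,5)] by simp
qed

text \<open>Numerator and denominator are both written as \<open>V = - c\<close> together with a
  measurable path event. Independence factors them, and the common factors cancel.\<close>

lemma (in prob_space) cond_prob_running_max_telegraph:
  assumes N: "homogeneous_poisson_process r N" and r: "0 < r" and t: "0 < t" and c: "0 < c"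
    and V: "prob {\<omega>\<in>space M. V \<omega> = - c} \<noteq> 0"
    and indep: "indep_set (sets (vimage_algebra (space M) V borel))
           (sets (vimage_algebra (space M) (\<lambda>\<omega>. restrict (\<lambda>s. N s \<omega>) {0..})
              (PiM {0..} (\<lambda>_. count_space UNIV))))"
  shows "\<P>(\<omega> in M. running_max (telegraph V N) t \<omega> = 0 \<bar> V \<omega> = - c \<and> N t \<omega> = n) =
    real (n choose (n div 2)) / 2 ^ n"
proof -
  let ?R = "\<lambda>\<omega>. restrict (\<lambda>s. N s \<omega>) {0..}" and ?PS = "PiM {0::real..} (\<lambda>_. count_space (UNIV :: nat set))"
  let ?V = "V -` {- c} \<inter> space M"
  have Vset: "?V \<in> sets (vimage_algebra (space M) V borel)"
    by (rule in_vimage_algebra) simp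
  have joint: "prob {\<omega>\<in>space M. V \<omega> = - c \<and> ?R \<omega> \<in> S} = prob {\<omega>\<in>space M. V \<omega> = - c} * prob {\<omega>\<in>space M. ?R \<omega> \<in> S}"
    if "S \<in> sets ?PS" for S
  proof -
    have "?V = {\<omega>\<in>space M. V \<omega> = - c}" "?R -` S \<inter> space M = {\<omega>\<in>space M. ?R \<omega> \<in> S}"
      "?V \<inter> (?R -` S \<inter> space M) = {\<omega>\<in>space M. V \<omega> = - c \<and> ?R \<omega> \<in> S}" by auto
    then show ?thesis
      using indep_setD[OF indep Vset in_vimage_algebra[OF that, of ?R "space M"]] by simp
  qed
  have ev: "(\<lambda>f. f t) \<in> measurable ?PS (count_space UNIV)"
    using t by (intro measurable_component_singleton) simp
  let ?S0 = "(\<lambda>f. f t) -` {n} \<inter> space ?PS"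
  \<comment> \<open>Independence concerns paths on \<open>{0..}\<close>, so the set of paths on
    \<open>{0..t}\<close> is pulled back along restriction.\<close>
  let ?S1 = "((\<lambda>f. restrict f {0..t}) -` nonneg_paths t \<inter> space ?PS) \<inter> ?S0"
  have S0: "?S0 \<in> sets ?PS" using ev by (rule measurable_sets) simp
  have "(\<lambda>f. restrict f {0..t}) -` nonneg_paths t \<inter> space ?PS \<in> sets ?PS"
    using t by (intro measurable_sets[OF measurable_restrict_subset] sets_nonneg_paths) auto
  then have S1: "?S1 \<in> sets ?PS" using S0 by (rule sets.Int)
  have R: "?R \<omega> \<in> space ?PS" "restrict (?R \<omega>) {0..t} = restrict (\<lambda>s. N s \<omega>) {0..t}" "?R \<omega> t = N t \<omega>" for \<omega>
    using t by (simp_all add: space_PiM fun_eq_iff)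
  have S0_iff: "?R \<omega> \<in> ?S0 \<longleftrightarrow> N t \<omega> = n" for \<omega>
    using R[of \<omega>] by simp
  have S1_iff: "?R \<omega> \<in> ?S1 \<longleftrightarrow> restrict (\<lambda>s. N s \<omega>) {0..t} \<in> nonneg_paths t \<and> N t \<omega> = n" for \<omega>
    using R[of \<omega>] by simp
  let ?p = "exp (- r * t) * (r * t) ^ n / fact n" and ?v = "prob {\<omega>\<in>space M. V \<omega> = - c}"
  have max_iff: "running_max (telegraph V N) t \<omega> = 0 \<longleftrightarrow> restrict (\<lambda>s. N s \<omega>) {0..t} \<in> nonneg_paths t"
    if "\<omega> \<in> space M" "V \<omega> = - c" for \<omega>
    using poisson_process_mono[OF N that(1)] poisson_process_right_const[OF N that(1)] c that(2) t
    by (intro running_max_telegraph_eq_0_iff) auto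
  have "prob {\<omega>\<in>space M. running_max (telegraph V N) t \<omega> = 0 \<and> V \<omega> = - c \<and> N t \<omega> = n} =
      prob {\<omega>\<in>space M. V \<omega> = - c \<and> ?R \<omega> \<in> ?S1}"
    unfolding S1_iff using max_iff by (intro arg_cong[where f = prob] Collect_cong) blast
  also have "\<dots> = ?v * (?p * (real (n choose (n div 2)) / 2 ^ n))"
    unfolding joint[OF S1] unfolding S1_iff prob_nonneg_path[OF N r t] ..
  finally have num: "prob {\<omega>\<in>space M. running_max (telegraph V N) t \<omega> = 0 \<and> V \<omega> = - c \<and> N t \<omega> = n} =
      ?v * (?p * (real (n choose (n div 2)) / 2 ^ n))" .
  have den: "prob {\<omega>\<in>space M. V \<omega> = - c \<and> N t \<omega> = n} = ?v * ?p"
    using joint[OF S0] unfolding S0_iff prob_poisson_count[OF N r t] .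
  have "?v * ?p \<noteq> 0" using V r t by simp
  then show ?thesis unfolding cond_prob_def num den by (simp add: field_simps)
qed

section \<open>Middle binomial coefficients and the conclusion\<close>

lemma central_binomial_step: "(2 * k + 2 choose (k + 1)) = 2 * (2 * k + 1 choose k)"
  using binomial_symmetric[of k "2 * k + 1"] by simp

text \<open>Symmetry moves the lower index to \<open>k + 1\<close>, where the absorption identity
  applies.\<close>

lemma odd_binomial_step: "(k + 1) * (2 * k + 1 choose k) = (2 * k + 1) * (2 * k choose k)"
proof -
  have "(2 * k + 1 choose k) = (2 * k + 1 choose (k + 1))"
    using binomial_symmetric[of k "2 * k + 1"] by simp
  then show ?thesis using Suc_times_binomial[of k "2 * k"] by simp
qed

theorem mainTheorem8:
  fixes M :: "'a measure" and c rate t :: real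
    and V :: "'a \<Rightarrow> real" and N :: "real \<Rightarrow> 'a \<Rightarrow> nat" and k :: nat
  assumes "prob_space M"
    and "c > 0" and "rate > 0" and "t > 0"
    and "V \<in> borel_measurable M"
    and "\<P>(\<omega> in M. V \<omega> = c) = 1 / 2" and "\<P>(\<omega> in M. V \<omega> = - c) = 1 / 2"
    and "prob_space.homogeneous_poisson_process M rate N"
    and "prob_space.indep_set M
           (sets (vimage_algebra (space M) V borel))
           (sets (vimage_algebra (space M) (\<lambda>\<omega>. restrict (\<lambda>s. N s \<omega>) {0..})
              (PiM {0..} (\<lambda>_. count_space UNIV))))"
  shows "\<P>(\<omega> in M. running_max (telegraph V N) t \<omega> = 0 \<bar> V \<omega> = - c \<and> N t \<omega> = 2 * k + 1) =
           \<P>(\<omega> in M. running_max (telegraph V N) t \<omega> = 0 \<bar> V \<omega> = - c \<and> N t \<omega> = 2 * k + 2) \<and>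
         \<P>(\<omega> in M. running_max (telegraph V N) t \<omega> = 0 \<bar> V \<omega> = - c \<and> N t \<omega> = 2 * k + 1) =
           real (2 * k + 1) / real (2 * k + 2) *
           \<P>(\<omega> in M. running_max (telegraph V N) t \<omega> = 0 \<bar> V \<omega> = - c \<and> N t \<omega> = 2 * k) \<and>
         \<P>(\<omega> in M. running_max (telegraph V N) t \<omega> = 0 \<bar> V \<omega> = - c \<and> N t \<omega> = 2 * k) >
           \<P>(\<omega> in M. running_max (telegraph V N) t \<omega> = 0 \<bar> V \<omega> = - c \<and> N t \<omega> = 2 * k + 1)"
proof -
  interpret prob_space M by fact
  define p where "p n = \<P>(\<omega> in M. running_max (telegraph V N) t \<omega> = 0 \<bar> V \<omega> = - c \<and> N t \<omega> = n)" for n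
  have p: "p n = real (n choose (n div 2)) / 2 ^ n" for n
    unfolding p_def using assms(7)
    by (intro cond_prob_running_max_telegraph[OF assms(8,3,4,2) _ assms(9)]) simp
  have p0: "p (2 * k) = real (2 * k choose k) / 2 ^ (2 * k)" by (simp add: p)
  have p1: "p (2 * k + 1) = real (2 * k + 1 choose k) / (2 * 2 ^ (2 * k))"
    unfolding p by simp
  have "(2 * k + 2) div 2 = k + 1" by simp
  \<comment> \<open>The doubling of the central coefficient offsets the extra factor 2 in the
    power.\<close>
  then have p2: "p (2 * k + 2) = p (2 * k + 1)"
    unfolding p1 unfolding p by (simp only: central_binomial_step) simp
  have "real (k + 1) * real (2 * k + 1 choose k) = real (2 * k + 1) * real (2 * k choose k)"
    using odd_binomial_step[of k] by (simp only: of_nat_mult[symmetric])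
  then have B: "real (2 * k + 1 choose k) = real (2 * k + 1) * real (2 * k choose k) / real (k + 1)"
    by (simp add: field_simps)
  have k2: "real (2 * k + 2) = 2 * real (k + 1)" by simp
  have p1': "p (2 * k + 1) = real (2 * k + 1) / real (2 * k + 2) * p (2 * k)"
    unfolding p0 p1 B k2 by (simp only: times_divide_times_eq divide_divide_eq_left mult_ac)
  \<comment> \<open>Positivity turns the ratio (2 k + 1) / (2 k + 2) < 1 into a strict
    inequality.\<close>
  have "0 < p (2 * k)" by (simp add: p0)
  then have "p (2 * k + 1) < p (2 * k)" unfolding p1' by (simp add: field_simps)
  with p1' p2 show ?thesis unfolding p_def by simp
qed

end
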